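(* Let $n\ge 1$, let $\rho\in S$ be a weight function on $\mathbb B_n$, and let $\mu$ be a finite positive Borel measure on $\mathbb B_n$. Then: (i) The Toeplitz operator $T_\mu$ is bounded on $A^2_\rho$ if and only if $\mu$ is a Carleson measure for $A^2_\rho$. (ii) The Toeplitz operator $T_\mu$ is compact on $A^2_\rho$ if and only if $\mu$ is a vanishing Carleson measure for $A^2_\rho$.
   Context: $\mathbb B_n$ is the open unit ball of $\mathbb C^n$, $dv$ the normalized volume measure on $\mathbb B_n$, $H(\mathbb B_n)$ the space of holomorphic functions on $\mathbb B_n$. A weight function is a positive continuous integrable function $\rho$ on $[0,1)$, extended to $\mathbb B_n$ by $\rho(z)=\rho(|z|)$, and normalized by $\int_0^1x^{2n-1}\rho(x)\,dx=1$. The points $r_k\in[0,1)$, $k\ge 0$, are determined by $\int_{r_k}^1\rho(x)\,dx=2^{-k}$. The class $S$ consists of the weights $\rho$ with $\inf_k\frac{1-r_k}{1-r_{k+1}}>1$. $A^2_\rho$ is the Hilbert space of $f\in H(\mathbb B_n)$ with $\|f\|_\rho^2=\int_{\mathbb B_n}|f|^2\rho\,dv<\infty$ and inner product $\langle f,g\rangle_\rho=\int_{\mathbb B_n}f\overline g\,\rho\,dv$; $K_\rho(z,w)$ is its reproducing kernel. For a finite positive Borel measure $\mu$ on $\mathbb B_n$, the Toeplitz operator $T_\mu$ is $$T_\mu f(z)=\int_{\mathbb B_n}K_\rho(z,w)f(w)\,d\mu(w),\qquad z\in\mathbb B_n,\ f\in A^2_\rho,$$ and it satisfies $\langle T_\mu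 f,g\rangle_\rho=\int_{\mathbb B_n}f\overline g\,d\mu$ for $f,g\in A^2_\rho$. Saying that $T_\mu$ is bounded (compact) means that this formula, with the integral absolutely convergent for every $f\in A^2_\rho$, defines a bounded (compact) operator $A^2_\rho\to A^2_\rho$. $\mu$ is a Carleson measure for $A^2_\rho$ if there is $C>0$ with $\int_{\mathbb B_n}|f|^2d\mu\le C\|f\|_\rho^2$ for all $f\in A^2_\rho$. A Carleson measure $\mu$ for $A^2_\rho$ is a vanishing Carleson measure if the inclusion $A^2_\rho\to L^2(\mathbb B_n,d\mu)$ is compact, that is, $\lim_{j\to\infty}\int_{\mathbb B_n}|f_j|^2d\mu=0$ whenever $\{f_j\}$ is a bounded sequence in $A^2_\rho$ converging to $0$ uniformly on compact subsets of $\mathbb B_n$. *)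

theory Defs
  imports "HOL-Analysis.Analysis"
begin

text \<open>
  The space of \<open>n\<close> complex variables is \<open>complex ^ 'n\<close> with \<open>n = CARD('n)\<close>; its norm is the
  Euclidean one, so the unit ball is \<open>ball 0 1\<close>.  Functions on the ball are total functions whose
  values outside the ball are irrelevant: every notion below inspects them on \<open>ball 0 1\<close> only.
\<close>

text \<open>Holomorphy in several variables: the Frechet derivative exists and is complex linear.\<close>

definition holomorphic_ball :: "(complex ^ 'n \<Rightarrow> complex) \<Rightarrow> bool" where
  "holomorphic_ball f \<longleftrightarrow>
     (\<forall>z \<in> ball 0 1. \<exists>D. (f has_derivative D) (at z) \<and> (\<forall>c v. D (c *s v) = c * D v))"

text \<open>A measure with space \<open>ball 0 1\<close>, so that measurability is only required on the ball.\<close>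

definition ball_volume_measure :: "(complex ^ 'n) measure" where
  "ball_volume_measure = uniform_measure (restrict_space lborel (ball 0 1)) (ball 0 1)"

definition weight_function :: "nat \<Rightarrow> (real \<Rightarrow> real) \<Rightarrow> bool" where
  "weight_function n \<rho> \<longleftrightarrow>
     (\<forall>x \<in> {0..<1}. 0 < \<rho> x) \<and> continuous_on {0..<1} \<rho> \<and> set_integrable lborel {0..<1} \<rho> \<and>
     (LBINT x:{0..<1}. x ^ (2 * n - 1) * \<rho> x) = 1"

text \<open>
  For a weight function the point exists and is unique: the tail integral is continuous and strictly
  decreasing, and at \<open>0\<close> it is at least \<open>1\<close> because of the normalization.
\<close>

definition weight_point :: "(real \<Rightarrow> real) \<Rightarrow> nat \<Rightarrow> real" where
  "weight_point \<rho> k = (THE r. r \<in> {0..<1} \<and> (LBINT x:{r..<1}. \<rho> x) = (1 / 2) ^ k)"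

definition weight_class_S :: "nat \<Rightarrow> (real \<Rightarrow> real) set" where
  "weight_class_S n =
     {\<rho>. weight_function n \<rho> \<and>
          (INF k. (1 - weight_point \<rho> k) / (1 - weight_point \<rho> (Suc k))) > 1}"

definition bergman_space :: "(real \<Rightarrow> real) \<Rightarrow> (complex ^ 'n \<Rightarrow> complex) set" where
  "bergman_space \<rho> =
     {f. holomorphic_ball f \<and> integrable ball_volume_measure (\<lambda>z. (cmod (f z))\<^sup>2 * \<rho> (norm z))}"

definition bergman_inner ::
    "(real \<Rightarrow> real) \<Rightarrow> (complex ^ 'n \<Rightarrow> complex) \<Rightarrow> (complex ^ 'n \<Rightarrow> complex) \<Rightarrow> complex" where
  "bergman_inner \<rho> f g =
     (\<integral>z. f z * cnj (g z) * complex_of_real (\<rho> (norm z)) \<partial>ball_volume_measure)"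

definition bergman_norm :: "(real \<Rightarrow> real) \<Rightarrow> (complex ^ 'n \<Rightarrow> complex) \<Rightarrow> real" where
  "bergman_norm \<rho> f = sqrt (\<integral>z. (cmod (f z))\<^sup>2 * \<rho> (norm z) \<partial>ball_volume_measure)"

definition is_reproducing_kernel ::
    "(real \<Rightarrow> real) \<Rightarrow> (complex ^ 'n \<Rightarrow> complex ^ 'n \<Rightarrow> complex) \<Rightarrow> bool" where
  "is_reproducing_kernel \<rho> K \<longleftrightarrow>
     (\<forall>w \<in> ball 0 1. (\<lambda>z. K z w) \<in> bergman_space \<rho> \<and>
        (\<forall>f \<in> bergman_space \<rho>. f w = bergman_inner \<rho> f (\<lambda>z. K z w)))"

text \<open>
  The choice is harmless: for a weight function a reproducing kernel exists, and any two of them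
  agree on \<open>ball 0 1 \<times> ball 0 1\<close>.
\<close>

definition bergman_kernel :: "(real \<Rightarrow> real) \<Rightarrow> complex ^ 'n \<Rightarrow> complex ^ 'n \<Rightarrow> complex" where
  "bergman_kernel \<rho> = (SOME K. is_reproducing_kernel \<rho> K)"

definition toeplitz ::
    "(real \<Rightarrow> real) \<Rightarrow> (complex ^ 'n) measure \<Rightarrow> (complex ^ 'n \<Rightarrow> complex) \<Rightarrow> complex ^ 'n \<Rightarrow> complex"
  where
  "toeplitz \<rho> \<mu> f z = (\<integral>w. bergman_kernel \<rho> z w * f w \<partial>\<mu>)"

text \<open>
  The integral formula defines an operator from the Bergman space to itself.  Absolute convergence
  has to be required explicitly, since the Bochner integral of a non-integrable function is \<open>0\<close>.
\<close>

definition toeplitz_defined :: "(real \<Rightarrow> real) \<Rightarrow> (complex ^ 'n) measure \<Rightarrow> bool" where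
  "toeplitz_defined \<rho> \<mu> \<longleftrightarrow>
     (\<forall>f \<in> bergman_space \<rho>.
        (\<forall>z \<in> ball 0 1. integrable \<mu> (\<lambda>w. bergman_kernel \<rho> z w * f w)) \<and>
        toeplitz \<rho> \<mu> f \<in> bergman_space \<rho>)"

definition toeplitz_bounded :: "(real \<Rightarrow> real) \<Rightarrow> (complex ^ 'n) measure \<Rightarrow> bool" where
  "toeplitz_bounded \<rho> \<mu> \<longleftrightarrow>
     toeplitz_defined \<rho> \<mu> \<and>
     (\<exists>C. \<forall>f \<in> bergman_space \<rho>. bergman_norm \<rho> (toeplitz \<rho> \<mu> f) \<le> C * bergman_norm \<rho> f)"

definition bergman_bounded_seq ::
    "(real \<Rightarrow> real) \<Rightarrow> (nat \<Rightarrow> complex ^ 'n \<Rightarrow> complex) \<Rightarrow> bool" where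
  "bergman_bounded_seq \<rho> f \<longleftrightarrow>
     (\<forall>j. f j \<in> bergman_space \<rho>) \<and> (\<exists>M. \<forall>j. bergman_norm \<rho> (f j) \<le> M)"

text \<open>
  Compactness of the operator: the image of every bounded sequence has a subsequence converging in
  norm to an element of the space.
\<close>

definition toeplitz_compact :: "(real \<Rightarrow> real) \<Rightarrow> (complex ^ 'n) measure \<Rightarrow> bool" where
  "toeplitz_compact \<rho> \<mu> \<longleftrightarrow>
     toeplitz_defined \<rho> \<mu> \<and>
     (\<forall>f. bergman_bounded_seq \<rho> f \<longrightarrow>
        (\<exists>g \<in> bergman_space \<rho>. \<exists>s. strict_mono s \<and>
           (\<lambda>j. bergman_norm \<rho> (\<lambda>z. toeplitz \<rho> \<mu> (f (s j)) z - g z)) \<longlonglongrightarrow> 0))"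

text \<open>The left-hand integral may be infinite, hence the nonnegative integral.\<close>

definition carleson_measure :: "(real \<Rightarrow> real) \<Rightarrow> (complex ^ 'n) measure \<Rightarrow> bool" where
  "carleson_measure \<rho> \<mu> \<longleftrightarrow>
     (\<exists>C>0. \<forall>f \<in> bergman_space \<rho>.
        (\<integral>\<^sup>+z. ennreal ((cmod (f z))\<^sup>2) \<partial>\<mu>) \<le> ennreal (C * (bergman_norm \<rho> f)\<^sup>2))"

definition vanishing_carleson_measure :: "(real \<Rightarrow> real) \<Rightarrow> (complex ^ 'n) measure \<Rightarrow> bool" where
  "vanishing_carleson_measure \<rho> \<mu> \<longleftrightarrow>
     carleson_measure \<rho> \<mu> \<and>
     (\<forall>f. bergman_bounded_seq \<rho> f \<and>
          (\<forall>A. compact A \<and> A \<subseteq> ball 0 1 \<longrightarrow> uniform_limit A f (\<lambda>_. 0) sequentially) \<longrightarrow>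
        (\<lambda>j. \<integral>\<^sup>+z. ennreal ((cmod (f j z))\<^sup>2) \<partial>\<mu>) \<longlonglongrightarrow> 0)"

end

theory Submission imports Defs "HOL-Complex_Analysis.Complex_Analysis" begin

text \<open>
  Everything rests on the form \<open>\<langle>T f, g\<rangle> = \<integral> f cnj g d\<mu>\<close>.  If \<open>\<mu>\<close> is Carleson, the right-hand side is
  bounded, so Riesz represents it by some \<open>h\<close> in the Bergman space, and testing against the kernel
  functions gives \<open>h = T f\<close>.  Conversely, if \<open>T\<close> is bounded, the form identity holds for \<open>g\<close> in the span
  of the kernel functions, and density with Fatou's lemma give the Carleson inequality.
  For compactness, a locally uniformly null bounded sequence is weakly null, so compactness of \<open>T\<close>
  gives \<open>\<integral> |f\<^sub>j|\<^sup>2 d\<mu> = \<langle>T f\<^sub>j, f\<^sub>j\<rangle> \<longlonglongrightarrow> 0\<close>; conversely, Montel's theorem produces from a bounded sequence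
  a subsequence with \<open>f\<^sub>j - f\<close> locally uniformly null, and \<open>\<parallel>T h\<parallel>\<^sup>2 \<le> C \<integral> |h|\<^sup>2 d\<mu>\<close>.
  Point evaluations are bounded because \<open>|f|\<^sup>2\<close> satisfies the sub-mean-value inequality over balls: average
  the one-variable inequality over the rotations \<open>v \<mapsto> e\<^sup>i\<^sup>\<theta> v\<close>, which preserve Lebesgue measure.
\<close>

section \<open>Semi-inner-product spaces of functions\<close>

text \<open>Functions are total but inspected on the ball only, so \<open>bergman_inner\<close> is
  merely semidefinite: functions that differ outside the ball are at distance zero. The Hilbert
  space arguments therefore run on a set of functions with a semi-inner product, and two elements
  are identified by evaluating them at points of the ball through the kernel. \<open>mu_form\<close>
  is a second instance of the same locale, and there degeneracy is genuine, for example for a point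
  mass.

  The Riesz theorem is stated for a subspace \<open>W\<close> that need not be closed; the
  representing element is a norm limit of elements of \<open>W\<close>. With \<open>W\<close> the
  whole space this represents functionals; applied on \<open>W\<close> to the inner product with a
  fixed \<open>f\<close> it approximates \<open>f\<close> from \<open>W\<close>, so density of the
  kernel span is available without ever forming the span.

  The obstacle on the way from boundedness of \<open>T\<close> to the Carleson inequality is that
  \<open>f cnj g\<close> is not yet known to be integrable, and a Bochner integral without
  integrability silently returns 0.\<close>

locale complex_semi_inner =
  fixes V :: "('x \<Rightarrow> complex) set" and B :: "('x \<Rightarrow> complex) \<Rightarrow> ('x \<Rightarrow> complex) \<Rightarrow> complex"
  assumes zero_mem: "(\<lambda>x. 0) \<in> V"
    and add_mem: "f \<in> V \<Longrightarrow> g \<in> V \<Longrightarrow> (\<lambda>x. f x + g x) \<in> V"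
    and scale_mem: "f \<in> V \<Longrightarrow> (\<lambda>x. c * f x) \<in> V"
    and add_left: "f \<in> V \<Longrightarrow> g \<in> V \<Longrightarrow> h \<in> V \<Longrightarrow> B (\<lambda>x. f x + g x) h = B f h + B g h"
    and scale_left: "f \<in> V \<Longrightarrow> h \<in> V \<Longrightarrow> B (\<lambda>x. c * f x) h = c * B f h"
    and cnj_commute: "f \<in> V \<Longrightarrow> g \<in> V \<Longrightarrow> B g f = cnj (B f g)"
    and nonneg: "f \<in> V \<Longrightarrow> 0 \<le> Re (B f f)"
begin

definition N :: "('x \<Rightarrow> complex) \<Rightarrow> real" where
  "N f = sqrt (Re (B f f))"

lemma diff_mem: "f \<in> V \<Longrightarrow> g \<in> V \<Longrightarrow> (\<lambda>x. f x - g x) \<in> V"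
  using add_mem[of f "\<lambda>x. (-1) * g x"] scale_mem[of g "-1"] by simp

lemma diff_left:
  "f \<in> V \<Longrightarrow> g \<in> V \<Longrightarrow> h \<in> V \<Longrightarrow> B (\<lambda>x. f x - g x) h = B f h - B g h"
  using add_left[of f "\<lambda>x. (-1) * g x" h] scale_left[of g h "-1"] scale_mem[of g "-1"] by simp

lemma add_right:
  assumes "f \<in> V" "g \<in> V" "h \<in> V"
  shows "B h (\<lambda>x. f x + g x) = B h f + B h g"
  unfolding cnj_commute[OF add_mem[OF assms(1,2)] assms(3)] add_left[OF assms]
    cnj_commute[OF assms(1,3)] cnj_commute[OF assms(2,3)] by simp

lemma scale_right:
  assumes "f \<in> V" "h \<in> V"
  shows "B h (\<lambda>x. c * f x) = cnj c * B h f"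
  unfolding cnj_commute[OF scale_mem[OF assms(1)] assms(2)] scale_left[OF assms]
    cnj_commute[OF assms] by simp

lemma diff_right:
  assumes "f \<in> V" "g \<in> V" "h \<in> V"
  shows "B h (\<lambda>x. f x - g x) = B h f - B h g"
  unfolding cnj_commute[OF diff_mem[OF assms(1,2)] assms(3)] diff_left[OF assms]
    cnj_commute[OF assms(1,3)] cnj_commute[OF assms(2,3)] by simp

lemma N_nonneg: "0 \<le> N f" if "f \<in> V"
  using nonneg[OF that] by (simp add: N_def)

lemma N_sq: "f \<in> V \<Longrightarrow> (N f)\<^sup>2 = Re (B f f)"
  using nonneg by (simp add: N_def)

lemma N_add_sq:
  assumes "f \<in> V" "g \<in> V"
  shows "(N (\<lambda>x. f x + g x))\<^sup>2 = (N f)\<^sup>2 + 2 * Re (B f g) + (N g)\<^sup>2"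
  using assms by (simp add: N_sq add_mem add_left add_right cnj_commute[of f g])

lemma N_diff_sq:
  assumes "f \<in> V" "g \<in> V"
  shows "(N (\<lambda>x. f x - g x))\<^sup>2 = (N f)\<^sup>2 - 2 * Re (B f g) + (N g)\<^sup>2"
  using assms by (simp add: N_sq diff_mem diff_left diff_right cnj_commute[of f g])

lemma N_scale: "f \<in> V \<Longrightarrow> N (\<lambda>x. c * f x) = cmod c * N f"
proof -
  assume f: "f \<in> V"
  have "B (\<lambda>x. c * f x) (\<lambda>x. c * f x) = complex_of_real ((cmod c)\<^sup>2) * B f f"
    using f by (simp add: scale_left scale_right scale_mem complex_norm_square del: of_real_power)
  then show ?thesis
    by (simp add: N_def real_sqrt_mult del: of_real_power)
qed

text \<open>Expand the square of the norm of \<open>f - s b g\<close> with real \<open>s\<close> and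
  \<open>b = B f g\<close>; the factor \<open>b\<close> aligns the phases and leaves a real
  polynomial in \<open>s\<close>. Its minimiser \<open>1 / (N g)^2\<close> exists only for nonzero
  \<open>N g\<close>, and semidefiniteness does not exclude \<open>N g = 0\<close>, hence the case
  split.\<close>

lemma Cauchy_Schwarz:
  assumes f: "f \<in> V" and g: "g \<in> V"
  shows "cmod (B f g) \<le> N f * N g"
proof -
  define b where "b = B f g"
  have key: "0 \<le> (N f)\<^sup>2 - 2 * s * (cmod b)\<^sup>2 + s\<^sup>2 * (cmod b)\<^sup>2 * (N g)\<^sup>2" for s
  proof -
    let ?c = "complex_of_real s * b"
    have "0 \<le> (N (\<lambda>x. f x - ?c * g x))\<^sup>2" by simp
    also have "\<dots> = (N f)\<^sup>2 - 2 * Re (cnj ?c * b) + (cmod ?c * N g)\<^sup>2"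
      using f g by (simp only: N_diff_sq scale_mem N_scale scale_right b_def)
    also have "Re (cnj ?c * b) = s * (cmod b)\<^sup>2"
      by (simp only: cmod_power2) (simp add: power2_eq_square algebra_simps)
    finally show ?thesis
      by (simp add: norm_mult power_mult_distrib algebra_simps)
  qed
  have "(cmod b)\<^sup>2 \<le> (N f)\<^sup>2 * (N g)\<^sup>2"
  proof (cases "N g = 0")
    case True
    show ?thesis
    proof (cases "b = 0")
      case False
      then have b0: "(cmod b)\<^sup>2 \<noteq> 0" by simp
      \<comment> \<open>With \<open>N g = 0\<close> the polynomial is affine in \<open>s\<close>;
        this value of \<open>s\<close> makes it \<open>- (N f)^2 - 2\<close>, which is
        negative.\<close>
      have "2 * (((N f)\<^sup>2 + 1) / (cmod b)\<^sup>2) * (cmod b)\<^sup>2 = 2 * ((N f)\<^sup>2 + 1)"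
        using b0 by simp
      with key[of "((N f)\<^sup>2 + 1) / (cmod b)\<^sup>2"] True
      have "0 \<le> (N f)\<^sup>2 - (2 * (N f)\<^sup>2 + 2)" by (simp add: distrib_left)
      moreover have "0 \<le> (N f)\<^sup>2" by simp
      ultimately have False by linarith
      then show ?thesis ..
    qed simp
  next
    case False
    then have G: "0 < (N g)\<^sup>2" by simp
    have "(1 / G)\<^sup>2 * b * G = 1 / G * b" if "0 < G" for G b :: real
      using that by (simp add: power2_eq_square)
    from this[OF G, of "(cmod b)\<^sup>2"] key[of "1 / (N g)\<^sup>2"]
    have "0 \<le> (N f)\<^sup>2 - (cmod b)\<^sup>2 / (N g)\<^sup>2" by (simp only:) simp
    with G show ?thesis by (simp add: pos_divide_le_eq)
  qed
  then show ?thesis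
    unfolding b_def[symmetric] power_mult_distrib[symmetric]
    by (rule power2_le_imp_le) (simp add: N_nonneg f g)
qed

lemma N_triangle:
  assumes f: "f \<in> V" and g: "g \<in> V"
  shows "N (\<lambda>x. f x + g x) \<le> N f + N g"
proof (rule power2_le_imp_le)
  have "Re (B f g) \<le> N f * N g"
    using Cauchy_Schwarz[OF f g] complex_Re_le_cmod order_trans by blast
  then show "(N (\<lambda>x. f x + g x))\<^sup>2 \<le> (N f + N g)\<^sup>2"
    using f g by (simp add: N_add_sq power2_sum)
qed (use f g in \<open>simp add: N_nonneg\<close>)

lemma N_triangle_diff:
  assumes f: "f \<in> V" and g: "g \<in> V"
  shows "N (\<lambda>x. f x - g x) \<le> N f + N g"
proof -
  have "N (\<lambda>x. (-1) * g x) = N g" using N_scale[OF g, of "-1"] by simp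
  then show ?thesis
    using N_triangle[OF f scale_mem[OF g, of "-1"]] by simp
qed

lemma N_le_diff:
  assumes f: "f \<in> V" and g: "g \<in> V"
  shows "N f \<le> N (\<lambda>x. f x - g x) + N g"
  using N_triangle[OF diff_mem[OF f g] g] by simp

lemma N_diff_commute:
  assumes f: "f \<in> V" and g: "g \<in> V"
  shows "N (\<lambda>x. f x - g x) = N (\<lambda>x. g x - f x)"
  using N_scale[OF diff_mem[OF g f], of "-1"] by simp

lemma N_abs_diff_le:
  assumes f: "f \<in> V" and g: "g \<in> V"
  shows "\<bar>N f - N g\<bar> \<le> N (\<lambda>x. f x - g x)"
  using N_le_diff[OF f g] N_le_diff[OF g f] N_diff_commute[OF f g] by simp

end

locale complex_semi_hilbert = complex_semi_inner +
  assumes complete: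
    "(\<And>n::nat. u n \<in> V) \<Longrightarrow>
     (\<And>e. 0 < e \<Longrightarrow> \<exists>M. \<forall>m\<ge>M. \<forall>n\<ge>M. sqrt (Re (B (\<lambda>x. u m x - u n x) (\<lambda>x. u m x - u n x))) < e) \<Longrightarrow>
     \<exists>h\<in>V. (\<lambda>n. sqrt (Re (B (\<lambda>x. u n x - h x) (\<lambda>x. u n x - h x)))) \<longlonglongrightarrow> 0"
begin

text \<open>
  The approximants minimise \<open>\<parallel>w\<parallel>\<^sup>2 - 2 Re (L w)\<close> over \<open>W\<close>; the parallelogram law makes a
  minimising sequence Cauchy.
\<close>

theorem Riesz_representation:
  assumes W: "W \<subseteq> V" "(\<lambda>x. 0) \<in> W"
    and W_add: "\<And>f g. f \<in> W \<Longrightarrow> g \<in> W \<Longrightarrow> (\<lambda>x. f x + g x) \<in> W"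
    and W_scale: "\<And>f c. f \<in> W \<Longrightarrow> (\<lambda>x. c * f x) \<in> W"
    and L_add: "\<And>f g. f \<in> W \<Longrightarrow> g \<in> W \<Longrightarrow> L (\<lambda>x. f x + g x) = L f + L g"
    and L_scale: "\<And>f c. f \<in> W \<Longrightarrow> L (\<lambda>x. c * f x) = c * L f"
    and L_bound: "\<And>f. f \<in> W \<Longrightarrow> cmod (L f) \<le> C * N f"
  obtains h u where "h \<in> V" "\<And>n::nat. u n \<in> W" "(\<lambda>n. N (\<lambda>x. u n x - h x)) \<longlonglongrightarrow> 0"
    "\<And>g. g \<in> W \<Longrightarrow> L g = B g h"
proof -
  \<comment> \<open>If \<open>h\<close> represents \<open>L\<close>, then
    \<open>J f = (N (f - h))^2 - (N h)^2\<close>, so a minimising sequence approaches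
    \<open>h\<close>.\<close>
  define J where "J f = (N f)\<^sup>2 - 2 * Re (L f)" for f
  define m where "m = Inf (J ` W)"
  have WV: "f \<in> V" if "f \<in> W" for f using W that by blast
  have J_lower: "- C\<^sup>2 \<le> J f" if "f \<in> W" for f
  proof -
    have "Re (L f) \<le> C * N f"
      using L_bound[OF that] complex_Re_le_cmod order_trans by blast
    moreover have "0 \<le> (N f - C)\<^sup>2" by simp
    ultimately show ?thesis by (simp add: J_def power2_diff algebra_simps)
  qed
  then have bdd: "bdd_below (J ` W)" by (auto intro!: bdd_belowI2[of _ "- C\<^sup>2"])
  have m_le: "m \<le> J f" if "f \<in> W" for f
    unfolding m_def using bdd that by (rule cINF_lower)
  have "\<exists>f\<in>W. J f < m + 1 / real (Suc n)" for n
  proof -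
    have "Inf (J ` W) < m + 1 / real (Suc n)" by (simp add: m_def)
    then show ?thesis using cInf_lessD[of "J ` W"] W(2) by blast
  qed
  then obtain u where u: "\<And>n. u n \<in> W" and Ju: "\<And>n. J (u n) < m + 1 / real (Suc n)"
    by metis
  have uV: "\<And>n. u n \<in> V" using u WV by blast
  \<comment> \<open>The midpoint of \<open>f\<close> and \<open>g\<close> is again in
    \<open>W\<close>, so \<open>m\<close> bounds \<open>J\<close> there from below; the
    parallelogram identity turns this into a bound on the distance.\<close>
  have par: "(N (\<lambda>x. f x - g x))\<^sup>2 \<le> 2 * J f + 2 * J g - 4 * m" if f: "f \<in> W" and g: "g \<in> W" for f g
  proof -
    have h: "(\<lambda>x. (1/2) * (f x + g x)) \<in> W" using f g W_add W_scale by blast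
    have 1: "Re (L (\<lambda>x. (1/2) * (f x + g x))) = (Re (L f) + Re (L g)) / 2"
      by (simp only: L_scale[OF W_add[OF f g], of "1/2"] L_add[OF f g]) simp
    have 2: "(N (\<lambda>x. (1/2) * (f x + g x)))\<^sup>2 = ((N f)\<^sup>2 + 2 * Re (B f g) + (N g)\<^sup>2) / 4"
      by (simp only: N_scale[OF add_mem[OF WV[OF f] WV[OF g]], of "1/2"] power_mult_distrib
          N_add_sq[OF WV[OF f] WV[OF g]]) (simp add: power2_eq_square)
    have "J (\<lambda>x. (1/2) * (f x + g x)) =
        ((N f)\<^sup>2 + 2 * Re (B f g) + (N g)\<^sup>2) / 4 - Re (L f) - Re (L g)"
      by (simp only: J_def 1 2) (simp add: field_simps)
    with m_le[OF h] have "m \<le> ((N f)\<^sup>2 + 2 * Re (B f g) + (N g)\<^sup>2) / 4 - Re (L f) - Re (L g)"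
      by (simp only:)
    then show ?thesis
      unfolding N_diff_sq[OF WV[OF f] WV[OF g]] J_def by argo
  qed
  have "\<exists>M. \<forall>i\<ge>M. \<forall>j\<ge>M. N (\<lambda>x. u i x - u j x) < e" if e: "0 < e" for e
  proof -
    \<comment> \<open>Two members of index at least \<open>M\<close> exceed the infimum by less than
      \<open>1 / (M + 1)\<close> each, so \<open>par\<close> yields \<open>4 / (M + 1)\<close>;
      hence a quarter of \<open>e^2\<close>.\<close>
    obtain M where M: "inverse (real (Suc M)) < e\<^sup>2 / 4"
      using reals_Archimedean[of "e\<^sup>2 / 4"] e by auto
    have "N (\<lambda>x. u i x - u j x) < e" if "M \<le> i" "M \<le> j" for i j
    proof (rule power2_less_imp_less)
      have "1 / real (Suc i) \<le> 1 / real (Suc M)" "1 / real (Suc j) \<le> 1 / real (Suc M)"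
        using that by (simp_all add: frac_le)
      with par[OF u u, of i j] Ju[of i] Ju[of j] M[unfolded inverse_eq_divide]
      show "(N (\<lambda>x. u i x - u j x))\<^sup>2 < e\<^sup>2" by linarith
    qed (use \<open>0 < e\<close> in simp)
    then show ?thesis by blast
  qed
  then obtain h where h: "h \<in> V" and lim: "(\<lambda>n. N (\<lambda>x. u n x - h x)) \<longlonglongrightarrow> 0"
    using complete[of u, folded N_def, OF uV] by auto
  have "L g = B g h" if g: "g \<in> W" for g
  proof -
    \<comment> \<open>The minimum need not be attained in \<open>W\<close>, so stationarity is
      replaced by an estimate: moving \<open>u n\<close> by \<open>c g\<close> lowers
      \<open>J\<close> by less than \<open>1 / (n + 1)\<close>, which bounds the defect
      \<open>a n\<close>.\<close>
    define a where "a n = B g (u n) - L g" for n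
    \<comment> \<open>With denominator \<open>(N g)^2\<close> the \<open>c\<close> chosen below
      would be the exact minimiser; the added 1 keeps it defined when \<open>N g = 0\<close> and
      costs only an inequality.\<close>
    define G where "G = (N g)\<^sup>2 + 1"
    have G: "G > 0" by (simp add: G_def add_nonneg_pos)
    have a_bound: "(cmod (a n))\<^sup>2 \<le> G * (1 / real (Suc n))" for n
    proof -
      define c where "c = - cnj (a n) / complex_of_real G"
      have "J (\<lambda>x. u n x + c * g x) = J (u n) + 2 * Re (c * a n) + (cmod c)\<^sup>2 * (N g)\<^sup>2"
      proof -
        have 1: "(N (\<lambda>x. u n x + c * g x))\<^sup>2 =
            (N (u n))\<^sup>2 + 2 * Re (c * B g (u n)) + (cmod c)\<^sup>2 * (N g)\<^sup>2"
          using N_add_sq[OF uV[of n] scale_mem[OF WV[OF g], of c]]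
            scale_right[OF WV[OF g] uV[of n], of c] cnj_commute[OF WV[OF g] uV[of n]]
          by (simp only: N_scale[OF WV[OF g]] power_mult_distrib) simp
        have 2: "L (\<lambda>x. u n x + c * g x) = L (u n) + c * L g"
          by (simp only: L_add[OF u W_scale[OF g]] L_scale[OF g])
        show ?thesis
          by (simp only: J_def 1 2 a_def) (simp add: algebra_simps)
      qed
      moreover have "m \<le> J (\<lambda>x. u n x + c * g x)"
        using m_le W_add[OF u W_scale[OF g]] by blast
      ultimately have "0 \<le> 1 / real (Suc n) + 2 * Re (c * a n) + (cmod c)\<^sup>2 * (N g)\<^sup>2"
        using Ju[of n] by linarith
      also have "Re (c * a n) = - (cmod (a n))\<^sup>2 / G"
      proof -
        have "c * a n = complex_of_real (- (cmod (a n))\<^sup>2 / G)"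
          by (simp add: c_def complex_norm_square mult.commute[of "cnj (a n)"] del: of_real_power)
        then show ?thesis by (metis Re_complex_of_real)
      qed
      also have "(cmod c)\<^sup>2 = (cmod (a n))\<^sup>2 / G\<^sup>2"
        using G by (simp add: c_def norm_divide power_divide)
      also have "(cmod (a n))\<^sup>2 / G\<^sup>2 * (N g)\<^sup>2 \<le> (cmod (a n))\<^sup>2 / G"
      proof -
        have "(cmod (a n))\<^sup>2 / G\<^sup>2 * (N g)\<^sup>2 \<le> (cmod (a n))\<^sup>2 / G\<^sup>2 * G"
          by (intro mult_left_mono) (auto simp: G_def)
        also have "\<dots> = (cmod (a n))\<^sup>2 / G" using G by (simp add: power2_eq_square)
        finally show ?thesis .
      qed
      finally have "(cmod (a n))\<^sup>2 / G \<le> 1 / real (Suc n)" by simp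
      then show ?thesis using G by (simp add: field_simps)
    qed
    have "(\<lambda>n. (cmod (a n))\<^sup>2) \<longlonglongrightarrow> 0"
    proof (rule Lim_null_comparison[OF always_eventually])
      show "\<forall>n. norm ((cmod (a n))\<^sup>2) \<le> G * (1 / real (Suc n))"
        using a_bound by simp
      show "(\<lambda>n. G * (1 / real (Suc n))) \<longlonglongrightarrow> 0"
        using tendsto_mult[OF tendsto_const LIMSEQ_Suc[OF lim_1_over_n], of G] by simp
    qed
    then have "(\<lambda>n. sqrt ((cmod (a n))\<^sup>2)) \<longlonglongrightarrow> sqrt 0"
      by (rule tendsto_real_sqrt)
    then have "a \<longlonglongrightarrow> 0" by (simp add: tendsto_norm_zero_iff)
    then have "(\<lambda>n. a n + L g) \<longlonglongrightarrow> 0 + L g" by (intro tendsto_add tendsto_const)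
    then have 1: "(\<lambda>n. B g (u n)) \<longlonglongrightarrow> L g" by (simp add: a_def)
    have "(\<lambda>n. B g (u n) - B g h) \<longlonglongrightarrow> 0"
    proof (rule Lim_null_comparison[OF always_eventually])
      show "\<forall>n. norm (B g (u n) - B g h) \<le> N g * N (\<lambda>x. u n x - h x)"
        using Cauchy_Schwarz[OF WV[OF g] diff_mem[OF uV h]] diff_right[OF uV h WV[OF g]] by simp
      show "(\<lambda>n. N g * N (\<lambda>x. u n x - h x)) \<longlonglongrightarrow> 0"
        using tendsto_mult[OF tendsto_const lim, of "N g"] by simp
    qed
    then have "(\<lambda>n. B g (u n)) \<longlonglongrightarrow> B g h" by (rule LIM_zero_cancel)
    with 1 show ?thesis by (rule LIMSEQ_unique)
  qed
  with h u lim show ?thesis by (rule that)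
qed

end

section \<open>Mean values over balls\<close>

lemma nn_integral_lborel_translation:
  fixes c :: "'a::euclidean_space"
  assumes [measurable]: "f \<in> borel_measurable borel"
  shows "(\<integral>\<^sup>+x. f (c + x) \<partial>lborel) = (\<integral>\<^sup>+x. f x \<partial>lborel)"
proof -
  have "(\<integral>\<^sup>+x. f x \<partial>lborel) = (\<integral>\<^sup>+x. f x \<partial>distr lborel borel ((+) c))"
    by (simp add: lborel_distr_plus)
  then show ?thesis by (simp add: nn_integral_distr)
qed

lemma nn_integral_lborel_reflection:
  fixes c :: "'a::euclidean_space"
  assumes [measurable]: "f \<in> borel_measurable borel"
  shows "(\<integral>\<^sup>+x. f (c - x) \<partial>lborel) = (\<integral>\<^sup>+x. f x \<partial>lborel)"
proof -
  have "lborel = distr lborel borel (\<lambda>x. c - x)"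
    using lborel_affine[of "-1" c] by (simp add: density_1)
  then have "(\<integral>\<^sup>+x. f x \<partial>lborel) = (\<integral>\<^sup>+x. f x \<partial>distr lborel borel (\<lambda>x. c - x))"
    by simp
  then show ?thesis by (simp add: nn_integral_distr)
qed

text \<open>
  Uniqueness of Haar measure by Fubini: with \<open>B\<close> the unit ball, which \<open>L\<close> preserves, evaluate the
  double integral of the indicator of \<open>L x \<in> A \<and> L x + y \<in> B\<close> in both orders.
\<close>

lemma lborel_distr_orthogonal_transformation:
  fixes L :: "'a::euclidean_space \<Rightarrow> 'a"
  assumes L: "orthogonal_transformation L"
  shows "distr lborel borel L = lborel"
proof (rule measure_eqI)
  fix A assume "A \<in> sets (distr lborel borel L)"
  then have [measurable]: "A \<in> sets borel" by simp
  define B where "B = ball (0::'a) 1"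
  have [measurable]: "B \<in> sets borel" by (simp add: B_def)
  have lin: "linear L" using L by (rule orthogonal_transformation_linear)
  have [measurable]: "L \<in> borel_measurable borel"
    using lin by (intro borel_measurable_continuous_onI linear_continuous_on) (simp add: linear_conv_bounded_linear)
  have LB: "L x \<in> B \<longleftrightarrow> x \<in> B" for x
    using L by (simp add: B_def orthogonal_transformation_norm)
  have "(\<integral>\<^sup>+x. indicator A (L x) \<partial>lborel) * emeasure lborel B
      = (\<integral>\<^sup>+x. indicator A (L x) * (\<integral>\<^sup>+y. indicator B y \<partial>lborel) \<partial>lborel)"
    by (simp add: nn_integral_multc)
  also have "\<dots> = (\<integral>\<^sup>+x. indicator A (L x) * (\<integral>\<^sup>+y. indicator B (L x + y) \<partial>lborel) \<partial>lborel)"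
    by (simp only: nn_integral_lborel_translation[of "indicator B"] borel_measurable_indicator \<open>B \<in> sets borel\<close>)
  also have "\<dots> = (\<integral>\<^sup>+x. (\<integral>\<^sup>+y. indicator A (L x) * indicator B (L x + y) \<partial>lborel) \<partial>lborel)"
    by (simp add: nn_integral_cmult)
  also have "\<dots> = (\<integral>\<^sup>+y. (\<integral>\<^sup>+x. indicator A (L x) * indicator B (L x + y) \<partial>lborel) \<partial>lborel)"
    by (rule lborel_pair.Fubini') measurable
  also have "\<dots> = (\<integral>\<^sup>+y. (\<integral>\<^sup>+x. indicator A (L x - y) * indicator B (L x) \<partial>lborel) \<partial>lborel)"
  proof (rule nn_integral_cong)
    fix y :: 'a
    \<comment> \<open>Surjectivity turns the shift \<open>y\<close> in the target into a shift of
      the integration variable: \<open>L (x - y') + y = L x\<close>.\<close>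
    obtain y' where y: "y = L y'"
      using orthogonal_transformation_surj[OF L] by (metis surjD)
    have "(\<integral>\<^sup>+x. indicator A (L x) * indicator B (L x + y) \<partial>lborel) =
        (\<integral>\<^sup>+x. indicator A (L (- y' + x)) * indicator B (L (- y' + x) + y) \<partial>lborel)"
      by (rule nn_integral_lborel_translation[symmetric]) measurable
    then show "(\<integral>\<^sup>+x. indicator A (L x) * indicator B (L x + y) \<partial>lborel) =
        (\<integral>\<^sup>+x. indicator A (L x - y) * (indicator B (L x) :: ennreal) \<partial>lborel)"
      by (simp add: y linear_diff[OF lin])
  qed
  also have "\<dots> = (\<integral>\<^sup>+x. (\<integral>\<^sup>+y. indicator A (L x - y) * indicator B (L x) \<partial>lborel) \<partial>lborel)"
    by (rule lborel_pair.Fubini') measurable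
  also have "\<dots> = (\<integral>\<^sup>+x. (\<integral>\<^sup>+y. indicator A (L x - y) \<partial>lborel) * indicator B (L x) \<partial>lborel)"
    by (simp add: nn_integral_multc)
  also have "\<dots> = (\<integral>\<^sup>+x. emeasure lborel A * indicator B x \<partial>lborel)"
    by (simp add: nn_integral_lborel_reflection[of "indicator A"] LB indicator_def[of B])
  also have "\<dots> = emeasure lborel A * emeasure lborel B"
    by (simp add: nn_integral_cmult)
  finally have "(\<integral>\<^sup>+x. indicator A (L x) \<partial>lborel) * emeasure lborel B =
      emeasure lborel A * emeasure lborel B" .
  \<comment> \<open>The volume of the ball is positive and finite, so it cancels.\<close>
  moreover have "emeasure lborel B \<noteq> 0" "emeasure lborel B \<noteq> \<infinity>"
    using emeasure_lborel_ball_finite[of "0::'a" 1] emeasure_ball[of 1 "0::'a"] unit_ball_vol_pos[of "DIM('a)", THEN less_imp_neq]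
    by (auto simp: B_def)
  ultimately have "(\<integral>\<^sup>+x. indicator A (L x) \<partial>lborel) = emeasure lborel A"
    by (simp add: mult.commute[of _ "emeasure lborel B"] ennreal_mult_cancel_left)
  moreover have "(\<integral>\<^sup>+x. indicator A x \<partial>distr lborel borel L) = (\<integral>\<^sup>+x. indicator A (L x) \<partial>lborel)"
    by (rule nn_integral_distr) measurable
  ultimately show "emeasure (distr lborel borel L) A = emeasure lborel A"
    by simp
qed simp

section \<open>Complex lines through a point\<close>

lemma norm_vector_smult: "norm (c *s v) = cmod c * norm (v :: complex ^ 'n)"
  by (simp add: norm_vec_def L2_set_def norm_mult power_mult_distrib
      sum_distrib_left[symmetric] real_sqrt_mult)

lemma linear_vector_smult: "linear (\<lambda>v :: complex ^ 'n. c *s v)"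
  by (rule linearI) (simp_all add: vec_eq_iff algebra_simps)

lemma linear_vector_smult_left: "linear (\<lambda>c. c *s (v :: complex ^ 'n))"
  by (rule linearI) (simp_all add: vec_eq_iff algebra_simps)

lemma bounded_bilinear_vector_smult: "bounded_bilinear (\<lambda>c (v :: complex ^ 'n). c *s v)"
  by (rule bounded_bilinear.intro)
    (auto simp: vec_eq_iff algebra_simps norm_vector_smult intro!: exI[of _ 1])

lemmas continuous_on_vector_smult [continuous_intros] =
  bounded_bilinear.continuous_on[OF bounded_bilinear_vector_smult]

lemma orthogonal_transformation_vector_smult:
  "cmod c = 1 \<Longrightarrow> orthogonal_transformation (\<lambda>v :: complex ^ 'n. c *s v)"
  by (simp add: orthogonal_transformation linear_vector_smult norm_vector_smult)

text \<open>The chain rule yields the real derivative \<open>h |-> D (h *s v)\<close>; complex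
  linearity turns it into multiplication by \<open>D v\<close>, which is a complex
  derivative.\<close>

lemma slice_has_field_derivative:
  fixes f :: "complex ^ 'n \<Rightarrow> complex"
  assumes "(f has_derivative D) (at (z + \<zeta> *s v))" "\<And>c v. D (c *s v) = c * D v"
  shows "((\<lambda>\<zeta>. f (z + \<zeta> *s v)) has_field_derivative D v) (at \<zeta>)"
proof -
  have "((\<lambda>\<zeta>. z + \<zeta> *s v) has_derivative (\<lambda>h. h *s v)) (at \<zeta>)"
    using has_derivative_add[OF has_derivative_const[of z "at \<zeta>"]
      linear_imp_has_derivative[OF linear_vector_smult_left[of v], of "at \<zeta>"]]
    by simp
  from has_derivative_compose[OF this assms(1)]
  have "((\<lambda>\<zeta>. f (z + \<zeta> *s v)) has_derivative (\<lambda>h. D (h *s v))) (at \<zeta>)" .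
  then show ?thesis
    by (simp add: has_field_derivative_def assms(2) mult.commute[of _ "D v"])
qed

lemma holomorphic_ball_slice:
  fixes f :: "complex ^ 'n \<Rightarrow> complex"
  assumes "holomorphic_ball f" "\<And>\<zeta>. \<zeta> \<in> S \<Longrightarrow> z + \<zeta> *s v \<in> ball 0 1"
  shows "(\<lambda>\<zeta>. f (z + \<zeta> *s v)) holomorphic_on S"
  unfolding holomorphic_on_def
proof
  fix \<zeta> assume "\<zeta> \<in> S"
  then obtain D where "(f has_derivative D) (at (z + \<zeta> *s v))" "\<And>c v. D (c *s v) = c * D v"
    using assms unfolding holomorphic_ball_def by blast
  from slice_has_field_derivative[OF this] show "(\<lambda>\<zeta>. f (z + \<zeta> *s v)) field_differentiable at \<zeta> within S"
    using field_differentiable_at_within field_differentiable_def by blast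
qed

lemma holomorphic_ball_continuous_on: "holomorphic_ball f \<Longrightarrow> continuous_on (ball 0 1) f"
  unfolding holomorphic_ball_def
  by (meson continuous_at_imp_continuous_on has_derivative_continuous)

lemma circle_mean_value:
  assumes g: "g holomorphic_on cball 0 1"
  shows "((\<lambda>t. g (cis (2 * pi * t))) has_integral g 0) {0..1}"
proof -
  have "((\<lambda>u. g u / (u - 0)) has_contour_integral (2 * of_real pi * \<i> * g 0)) (circlepath 0 1)"
    using g by (rule Cauchy_integral_circlepath_simple) simp
  moreover have "circlepath 0 1 t = cis (2 * pi * t)" for t
    by (simp add: circlepath cis_conv_exp mult_ac)
  ultimately have "((\<lambda>t. g (cis (2 * pi * t)) / cis (2 * pi * t) *
      (2 * of_real pi * \<i> * cis (2 * pi * t))) has_integral (2 * of_real pi * \<i> * g 0)) {0..1}"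
    by (simp add: has_contour_integral vector_derivative_circlepath cis_conv_exp mult_ac)
  then have "((\<lambda>t. (2 * of_real pi * \<i>) * g (cis (2 * pi * t))) has_integral (2 * of_real pi * \<i>) * g 0) {0..1}"
    by (rule has_integral_eq[rotated]) simp
  from has_integral_mult_right[OF this, of "1 / (2 * of_real pi * \<i>)"]
  show ?thesis by simp
qed

text \<open>The square of \<open>g\<close> is again holomorphic, so its value at 0 is its mean over
  the circle; the modulus of a mean is at most the mean of the modulus. The extended integral over
  the line is the form that Fubini expects.\<close>

lemma circle_sub_mean_value_square:
  assumes g: "g holomorphic_on cball 0 1"
  shows "ennreal ((cmod (g 0))\<^sup>2) \<le>
    (\<integral>\<^sup>+t. ennreal ((cmod (g (cis (2 * pi * t))))\<^sup>2) * indicator {0..1} t \<partial>lborel)"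
proof -
  let ?c = "\<lambda>t. cis (2 * pi * t)"
  have "(\<lambda>u. (g u)\<^sup>2) holomorphic_on cball 0 1" using g by (intro holomorphic_intros)
  from circle_mean_value[OF this]
  have I: "((\<lambda>t. (g (?c t))\<^sup>2) has_integral (g 0)\<^sup>2) {0..1}" .
  have cont: "continuous_on {0..1} (\<lambda>t. (cmod (g (?c t)))\<^sup>2)"
    by (intro continuous_intros continuous_on_compose2[OF holomorphic_on_imp_continuous_on[OF g]]) auto
  then have int: "(\<lambda>t. (cmod (g (?c t)))\<^sup>2) integrable_on {0..1}"
    by (rule integrable_continuous_real)
  have "norm (integral {0..1} (\<lambda>t. (g (?c t))\<^sup>2)) \<le> integral {0..1} (\<lambda>t. (cmod (g (?c t)))\<^sup>2)"
    using I int by (intro integral_norm_bound_integral) (auto simp: norm_power)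
  then have "(cmod (g 0))\<^sup>2 \<le> integral {0..1} (\<lambda>t. (cmod (g (?c t)))\<^sup>2)"
    using I by (simp add: integral_unique norm_power)
  also have "\<dots> = integral\<^sup>L lborel (\<lambda>t. indicator {0..1} t *\<^sub>R (cmod (g (?c t)))\<^sup>2)"
    using set_borel_integral_eq_integral(2)[OF borel_integrable_atLeastAtMost', OF cont]
    by (simp add: set_lebesgue_integral_def)
  finally have "ennreal ((cmod (g 0))\<^sup>2) \<le> ennreal \<dots>"
    by (rule ennreal_leI)
  also have "\<dots> = (\<integral>\<^sup>+t. ennreal (indicator {0..1} t *\<^sub>R (cmod (g (?c t)))\<^sup>2) \<partial>lborel)"
    using borel_integrable_atLeastAtMost'[OF cont]
    by (intro nn_integral_eq_integral[symmetric]) (auto simp: set_integrable_def)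
  also have "\<dots> = (\<integral>\<^sup>+t. ennreal ((cmod (g (?c t)))\<^sup>2) * indicator {0..1} t \<partial>lborel)"
    by (intro nn_integral_cong) (simp add: indicator_def)
  finally show ?thesis .
qed

lemma holomorphic_ball_sub_mean_value_square:
  fixes f :: "complex ^ 'n \<Rightarrow> complex"
  assumes f: "holomorphic_ball f" and r: "ball z r \<subseteq> ball 0 1"
  shows "ennreal ((cmod (f z))\<^sup>2) * emeasure lborel (ball (0 :: complex ^ 'n) r) \<le>
    (\<integral>\<^sup>+w. ennreal ((cmod (f w))\<^sup>2) * indicator (ball z r) w \<partial>lborel)"
proof -
  let ?c = "\<lambda>t. cis (2 * pi * t)"
  \<comment> \<open>Centred at the origin, so that rotations preserve the cut-off. The cut-off also
    makes \<open>F\<close> measurable on the whole space, since \<open>f\<close> is unconstrained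
    outside the unit ball.\<close>
  define F where "F w = ennreal ((cmod (f (z + w)))\<^sup>2) * indicator (ball 0 r) w" for w
  have cont: "continuous_on (ball z r) f"
    using holomorphic_ball_continuous_on[OF f] r continuous_on_subset by blast
  have "(\<lambda>w. indicator (ball z r) w *\<^sub>R f w) \<in> borel_measurable borel"
    by (rule borel_measurable_continuous_on_indicator[OF _ cont]) simp
  then have "(\<lambda>w. ennreal ((cmod (indicator (ball z r) (z + w) *\<^sub>R f (z + w)))\<^sup>2)) \<in> borel_measurable borel"
    by measurable
  moreover have "F = (\<lambda>w. ennreal ((cmod (indicator (ball z r) (z + w) *\<^sub>R f (z + w)))\<^sup>2))"
    by (auto simp: F_def fun_eq_iff indicator_def dist_norm)
  ultimately have F[measurable]: "F \<in> borel_measurable borel" by simp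
  have rot_meas: "(\<lambda>(t, v). (?c t *s v :: complex ^ 'n)) \<in> borel_measurable (borel \<Otimes>\<^sub>M borel)"
    unfolding borel_prod case_prod_beta
    by (intro borel_measurable_continuous_onI continuous_intros continuous_on_cis)
  have [measurable]: "(\<lambda>(t, v). F (?c t *s v)) \<in> borel_measurable (borel \<Otimes>\<^sub>M borel)"
    using measurable_compose[OF rot_meas F] by (simp add: case_prod_beta)
  have rot: "(\<integral>\<^sup>+v. F (?c t *s v) \<partial>lborel) = (\<integral>\<^sup>+v. F v \<partial>lborel)" for t
  proof -
    have [measurable]: "(\<lambda>v :: complex ^ 'n. ?c t *s v) \<in> borel_measurable borel"
      by (intro borel_measurable_continuous_onI continuous_intros)
    have "(\<integral>\<^sup>+v. F v \<partial>lborel) = (\<integral>\<^sup>+v. F v \<partial>distr lborel borel (\<lambda>v. ?c t *s v))"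
      by (simp add: lborel_distr_orthogonal_transformation orthogonal_transformation_vector_smult)
    then show ?thesis by (simp add: nn_integral_distr)
  qed
  \<comment> \<open>For \<open>v\<close> in the ball, the closed disc spanned by \<open>v\<close>
    around \<open>z\<close> stays in \<open>ball z r\<close>: the one-variable inequality applies to
    the slice, and the cut-off equals 1 on its circle.\<close>
  have pt: "ennreal ((cmod (f z))\<^sup>2) * indicator (ball 0 r) v \<le>
      (\<integral>\<^sup>+t. F (?c t *s v) * indicator {0..1} t \<partial>lborel)" for v
  proof (cases "v \<in> ball 0 r")
    case True
    have in_ball: "z + \<zeta> *s v \<in> ball 0 1" if "\<zeta> \<in> cball 0 1" for \<zeta>
    proof -
      have "norm (\<zeta> *s v) \<le> 1 * norm v"
        unfolding norm_vector_smult using that by (intro mult_right_mono) auto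
      with True have "z + \<zeta> *s v \<in> ball z r" by (simp add: dist_norm)
      with r show ?thesis by blast
    qed
    from circle_sub_mean_value_square[OF holomorphic_ball_slice[OF f in_ball]] True
    show ?thesis
      by (simp add: F_def norm_vector_smult)
  qed simp
  have "ennreal ((cmod (f z))\<^sup>2) * emeasure lborel (ball (0 :: complex ^ 'n) r) =
      (\<integral>\<^sup>+v. ennreal ((cmod (f z))\<^sup>2) * indicator (ball 0 r) v \<partial>(lborel :: (complex ^ 'n) measure))"
    by (simp add: nn_integral_cmult_indicator)
  also have "\<dots> \<le> (\<integral>\<^sup>+v. (\<integral>\<^sup>+t. F (?c t *s v) * indicator {0..1} t \<partial>lborel) \<partial>lborel)"
    by (intro nn_integral_mono pt)
  also have "\<dots> = (\<integral>\<^sup>+t. (\<integral>\<^sup>+v. F (?c t *s v) * indicator {0..1} t \<partial>lborel) \<partial>lborel)"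
    by (rule lborel_pair.Fubini') measurable
  also have "\<dots> = (\<integral>\<^sup>+t. (\<integral>\<^sup>+v. F v \<partial>lborel) * indicator {0..1::real} t \<partial>lborel)"
    by (simp add: nn_integral_multc rot)
  also have "\<dots> = (\<integral>\<^sup>+v. F v \<partial>lborel)"
    by (simp add: nn_integral_cmult)
  also have "\<dots> = (\<integral>\<^sup>+v. ennreal ((cmod (f (z + v)))\<^sup>2) * indicator (ball z r) (z + v) \<partial>lborel)"
    by (intro nn_integral_cong) (simp add: F_def indicator_def dist_norm)
  also have "\<dots> = (\<integral>\<^sup>+w. ennreal ((cmod (f w))\<^sup>2) * indicator (ball z r) w \<partial>lborel)"
  proof (rule nn_integral_lborel_translation)
    have "(\<lambda>w. ennreal ((cmod (indicator (ball z r) w *\<^sub>R f w))\<^sup>2)) \<in> borel_measurable borel"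
      using borel_measurable_continuous_on_indicator[OF _ cont] by measurable
    moreover have "(\<lambda>w. ennreal ((cmod (indicator (ball z r) w *\<^sub>R f w))\<^sup>2)) =
        (\<lambda>w. ennreal ((cmod (f w))\<^sup>2) * indicator (ball z r) w)"
      by (auto simp: fun_eq_iff indicator_def)
    ultimately show "(\<lambda>w. ennreal ((cmod (f w))\<^sup>2) * indicator (ball z r) w) \<in> borel_measurable borel"
      by (simp only:)
  qed
  finally show ?thesis .
qed

section \<open>Holomorphic functions on the unit ball\<close>

lemma holomorphic_ball_const: "holomorphic_ball (\<lambda>z. c)"
  unfolding holomorphic_ball_def by (intro ballI exI[of _ "\<lambda>h. 0"]) simp

lemma holomorphic_ball_add:
  assumes "holomorphic_ball f" "holomorphic_ball g"
  shows "holomorphic_ball (\<lambda>z. f z + g z)"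
  unfolding holomorphic_ball_def
proof
  fix z :: "complex ^ 'a" assume "z \<in> ball 0 1"
  with assms obtain D E where D: "(f has_derivative D) (at z)" "\<forall>c v. D (c *s v) = c * D v"
    and E: "(g has_derivative E) (at z)" "\<forall>c v. E (c *s v) = c * E v"
    unfolding holomorphic_ball_def by meson
  then show "\<exists>D. ((\<lambda>z. f z + g z) has_derivative D) (at z) \<and> (\<forall>c v. D (c *s v) = c * D v)"
    by (intro exI[of _ "\<lambda>h. D h + E h"]) (auto intro: has_derivative_add simp: algebra_simps)
qed

lemma holomorphic_ball_scale:
  assumes "holomorphic_ball f"
  shows "holomorphic_ball (\<lambda>z. c * f z)"
  unfolding holomorphic_ball_def
proof
  fix z :: "complex ^ 'a" assume "z \<in> ball 0 1"
  with assms obtain D where D: "(f has_derivative D) (at z)" "\<forall>c v. D (c *s v) = c * D v"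
    unfolding holomorphic_ball_def by meson
  then show "\<exists>D. ((\<lambda>z. c * f z) has_derivative D) (at z) \<and> (\<forall>c v. D (c *s v) = c * D v)"
    by (intro exI[of _ "\<lambda>h. c * D h"]) (auto intro: has_derivative_mult_right)
qed

lemma holomorphic_ball_diff:
  "holomorphic_ball f \<Longrightarrow> holomorphic_ball g \<Longrightarrow> holomorphic_ball (\<lambda>z. f z - g z)"
  using holomorphic_ball_add[of f "\<lambda>z. (-1) * g z"] holomorphic_ball_scale[of g "-1"] by simp

lemma holomorphic_ball_cong:
  assumes f: "holomorphic_ball f" and eq: "\<And>z. z \<in> ball 0 1 \<Longrightarrow> f z = g z"
  shows "holomorphic_ball g"
  unfolding holomorphic_ball_def
proof
  fix z :: "complex ^ 'a" assume z: "z \<in> ball 0 1"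
  with f obtain D where D: "(f has_derivative D) (at z)" "\<forall>c v. D (c *s v) = c * D v"
    unfolding holomorphic_ball_def by meson
  then have "(g has_derivative D) (at z)"
    using has_derivative_transform_within_open[OF D(1) open_ball z eq] by blast
  with D(2) show "\<exists>D. (g has_derivative D) (at z) \<and> (\<forall>c v. D (c *s v) = c * D v)"
    by blast
qed

section \<open>Cauchy estimates, Weierstrass convergence and normal families\<close>

lemma holomorphic_ball_frechet_derivative:
  assumes "holomorphic_ball f" "z \<in> ball 0 1"
  shows "(f has_derivative frechet_derivative f (at z)) (at z)"
    and "frechet_derivative f (at z) (c *s v) = c * frechet_derivative f (at z) v"
proof -
  obtain D where D: "(f has_derivative D) (at z)" "\<forall>c v. D (c *s v) = c * D v"
    using assms unfolding holomorphic_ball_def by meson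
  moreover have "D = frechet_derivative f (at z)" using D(1) by (rule frechet_derivative_at)
  ultimately show "(f has_derivative frechet_derivative f (at z)) (at z)"
    and "frechet_derivative f (at z) (c *s v) = c * frechet_derivative f (at z) v" by auto
qed

text \<open>The derivative in direction \<open>v\<close> is the one-variable derivative at 0 of the
  slice \<open>\<zeta> |-> f (z + \<zeta> *s v)\<close>, to which Cauchy's inequality on a disc
  applies.\<close>

lemma holomorphic_ball_Cauchy_estimate:
  fixes f :: "complex ^ 'n \<Rightarrow> complex"
  assumes f: "holomorphic_ball f" and r: "0 < r" "cball z r \<subseteq> ball 0 1"
    and M: "\<And>w. w \<in> cball z r \<Longrightarrow> cmod (f w) \<le> M"
  shows "cmod (frechet_derivative f (at z) v) \<le> M / r * norm v"
proof (cases "v = 0")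
  case True
  have "z \<in> ball 0 1" using r by (auto simp: subset_eq)
  from holomorphic_ball_frechet_derivative(2)[OF f this, of 0 v]
  show ?thesis using True by simp
next
  case False
  have z: "z \<in> ball 0 1" using r by (auto simp: subset_eq)
  \<comment> \<open>The largest radius for which the slice stays in \<open>cball z r\<close>; the
    division is why \<open>v = 0\<close> is treated apart.\<close>
  define s where "s = r / norm v"
  have s: "0 < s" using False r by (simp add: s_def)
  have in_cball: "z + \<zeta> *s v \<in> cball z r" if "\<zeta> \<in> cball 0 s" for \<zeta>
    using that False by (simp add: s_def dist_norm norm_vector_smult field_simps)
  then have hol: "(\<lambda>\<zeta>. f (z + \<zeta> *s v)) holomorphic_on cball 0 s"
    using r by (intro holomorphic_ball_slice f) blast
  have "((\<lambda>\<zeta>. f (z + \<zeta> *s v)) has_field_derivative frechet_derivative f (at z) v) (at 0)"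
    by (rule slice_has_field_derivative)
      (use holomorphic_ball_frechet_derivative[OF f z] in simp_all)
  then have "cmod (frechet_derivative f (at z) v) = cmod ((deriv ^^ 1) (\<lambda>\<zeta>. f (z + \<zeta> *s v)) 0)"
    by (simp add: DERIV_imp_deriv)
  also have "\<dots> \<le> fact 1 * M / s ^ 1"
    by (rule Cauchy_inequality)
      (use s hol M in_cball in \<open>auto intro: holomorphic_on_subset holomorphic_on_imp_continuous_on\<close>)
  finally show ?thesis using False r by (simp add: s_def)
qed

text \<open>The gap from \<open>R\<close> to 1 is halved: one half is the radius for Cauchy
  estimates at points of \<open>cball 0 R\<close>, the other keeps all the balls used there at a
  fixed distance from the unit sphere.\<close>

lemma cball_half_gap:
  fixes x :: "'a::real_normed_vector"
  assumes "0 < R" "R < 1" "x \<in> cball 0 R"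
  shows "cball x ((1 - R) / 2) \<subseteq> cball 0 ((1 + R) / 2)"
proof
  fix w assume "w \<in> cball x ((1 - R) / 2)"
  then have "norm (w - x) \<le> (1 - R) / 2" by (simp add: dist_norm norm_minus_commute)
  moreover have "norm x \<le> R" using assms by simp
  ultimately show "w \<in> cball 0 ((1 + R) / 2)"
    using norm_triangle_sub[of w x] by (simp add: field_simps)
qed

lemma holomorphic_ball_derivative_bound:
  fixes f :: "complex ^ 'n \<Rightarrow> complex"
  assumes f: "holomorphic_ball f" and R: "0 < R" "R < 1"
    and M: "\<And>w. w \<in> cball 0 ((1 + R) / 2) \<Longrightarrow> cmod (f w) \<le> M"
    and x: "x \<in> cball 0 R"
  shows "cmod (frechet_derivative f (at x) v) \<le> M / ((1 - R) / 2) * norm v"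
proof (rule holomorphic_ball_Cauchy_estimate[OF f])
  show "cball x ((1 - R) / 2) \<subseteq> ball 0 1"
    using cball_half_gap[OF R x] R by (auto simp: subset_eq)
  show "cmod (f w) \<le> M" if "w \<in> cball x ((1 - R) / 2)" for w
    using M cball_half_gap[OF R x] that by blast
qed (use R in simp)

text \<open>Weierstrass' theorem: Cauchy estimates for the differences \<open>f m - f n\<close> make
  the derivatives uniformly Cauchy on a smaller ball, so limit and differentiation may be exchanged;
  complex linearity survives the pointwise limit.\<close>

lemma holomorphic_ball_uniform_sequence:
  fixes f :: "nat \<Rightarrow> complex ^ 'n \<Rightarrow> complex"
  assumes f: "\<And>j. holomorphic_ball (f j)"
    and Cauchy: "\<And>R. 0 < R \<Longrightarrow> R < 1 \<Longrightarrow> uniformly_Cauchy_on (cball 0 R) f"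
  obtains g where "holomorphic_ball g"
    "\<And>R. 0 < R \<Longrightarrow> R < 1 \<Longrightarrow> uniform_limit (cball 0 R) f g sequentially"
proof -
  define g where "g z = lim (\<lambda>j. f j z)" for z
  have lim: "uniform_limit (cball 0 R) f g sequentially" if "0 < R" "R < 1" for R
    using Cauchy_uniformly_convergent[OF Cauchy[OF that]]
    unfolding uniformly_convergent_uniform_limit_iff g_def[abs_def] .
  have "holomorphic_ball g"
    unfolding holomorphic_ball_def
  proof
    fix z :: "complex ^ 'n" assume "z \<in> ball 0 1"
    define R where "R = (1 + norm z) / 2"
    have nz: "norm z < 1" using \<open>z \<in> ball 0 1\<close> by simp
    then have R: "0 < R" "R < 1"
      unfolding R_def using norm_ge_zero[of z] by (simp_all add: add_pos_nonneg)
    have zR: "z \<in> ball 0 R" using nz by (simp add: R_def field_simps)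
    have R': "0 < (1 + R) / 2" "(1 + R) / 2 < 1" using R by auto
    define f' where "f' j x = frechet_derivative (f j) (at x)" for j x
    define g' where "g' x h = lim (\<lambda>j. f' j x h)" for x h
    have f'_deriv: "(f j has_derivative f' j x) (at x)" "f' j x (c *s v) = c * f' j x v"
      if "x \<in> ball 0 R" for j x c v
      unfolding f'_def using that R by (intro holomorphic_ball_frechet_derivative f; simp)+
    have f'_Cauchy: "\<exists>N. \<forall>m\<ge>N. \<forall>n\<ge>N. \<forall>x\<in>ball 0 R. \<forall>h. norm (f' m x h - f' n x h) \<le> e * norm h"
      if e: "0 < e" for e
    proof -
      have "0 < e * ((1 - R) / 2)" using e R by simp
      then obtain N where N: "\<And>w m n. w \<in> cball 0 ((1 + R) / 2) \<Longrightarrow> m \<ge> N \<Longrightarrow> n \<ge> N \<Longrightarrow>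
          dist (f m w) (f n w) < e * ((1 - R) / 2)"
        using Cauchy[OF R'] unfolding uniformly_Cauchy_on_def by meson
      have "norm (f' m x h - f' n x h) \<le> e * norm h" if "m \<ge> N" "n \<ge> N" "x \<in> ball 0 R" for m n x h
      proof -
        have "((\<lambda>w. f m w - f n w) has_derivative (\<lambda>h. f' m x h - f' n x h)) (at x)"
          using f'_deriv that by (intro has_derivative_diff)
        then have "(\<lambda>h. f' m x h - f' n x h) = frechet_derivative (\<lambda>w. f m w - f n w) (at x)"
          by (rule frechet_derivative_at)
        then have "norm (f' m x h - f' n x h) = norm (frechet_derivative (\<lambda>w. f m w - f n w) (at x) h)"
          by (rule arg_cong[where f = "\<lambda>F. norm (F h)"])
        also have "\<dots> \<le> e * ((1 - R) / 2) / ((1 - R) / 2) * norm h"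
          using N[OF _ that(1,2)] that(3)
          by (intro holomorphic_ball_derivative_bound holomorphic_ball_diff f R)
            (auto simp: dist_norm intro: less_imp_le)
        finally show ?thesis using R by simp
      qed
      then show ?thesis by blast
    qed
    have g'_lim: "(\<lambda>j. f' j x h) \<longlonglongrightarrow> g' x h" if x: "x \<in> ball 0 R" for x h
    proof -
      have "Cauchy (\<lambda>j. f' j x h)"
      proof (rule CauchyI)
        fix e :: real assume "0 < e"
        then have "0 < e / (norm h + 1)" by (simp add: add_nonneg_pos)
        from f'_Cauchy[OF this] obtain N where
          N: "\<And>m n. m \<ge> N \<Longrightarrow> n \<ge> N \<Longrightarrow> norm (f' m x h - f' n x h) \<le> e / (norm h + 1) * norm h"
          using x by meson
        have nh: "0 < norm h + 1" by (simp add: add_nonneg_pos)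
        then have "e / (norm h + 1) * norm h < e / (norm h + 1) * (norm h + 1)"
          using \<open>0 < e\<close> by (intro mult_strict_left_mono) auto
        also have "\<dots> = e" using nh by simp
        finally have "e / (norm h + 1) * norm h < e" .
        with N show "\<exists>N. \<forall>m\<ge>N. \<forall>n\<ge>N. norm (f' m x h - f' n x h) < e"
          by (meson le_less_trans)
      qed
      then show ?thesis unfolding g'_def by (simp add: Cauchy_convergent_iff convergent_LIMSEQ_iff)
    qed
    have "\<exists>G. \<forall>x\<in>ball 0 R. (\<lambda>n. f n x) \<longlonglongrightarrow> G x \<and> (G has_derivative g' x) (at x within ball 0 R)"
    proof (rule has_derivative_sequence[where f' = f'])
      show "(f n has_derivative f' n x) (at x within ball 0 R)" if "x \<in> ball 0 R" for n x
        using f'_deriv(1)[OF that] by (rule has_derivative_at_withinI)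
      show "\<forall>\<^sub>F n in sequentially. \<forall>x\<in>ball 0 R. \<forall>h. norm (f' n x h - g' x h) \<le> e * norm h"
        if "0 < e" for e
      proof -
        obtain N where N: "\<And>m n x h. m \<ge> N \<Longrightarrow> n \<ge> N \<Longrightarrow> x \<in> ball 0 R \<Longrightarrow>
            norm (f' m x h - f' n x h) \<le> e * norm h"
          using f'_Cauchy[OF \<open>0 < e\<close>] by meson
        have "norm (f' n x h - g' x h) \<le> e * norm h" if "n \<ge> N" "x \<in> ball 0 R" for n x h
        proof (rule tendsto_upperbound)
          show "(\<lambda>m. norm (f' n x h - f' m x h)) \<longlonglongrightarrow> norm (f' n x h - g' x h)"
            by (intro tendsto_intros g'_lim that)
          show "\<forall>\<^sub>F m in sequentially. norm (f' n x h - f' m x h) \<le> e * norm h"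
            using N that unfolding eventually_sequentially by blast
        qed simp
        then show ?thesis unfolding eventually_sequentially by blast
      qed
      show "z \<in> ball 0 R" by (rule zR)
      show "(\<lambda>n. f n z) \<longlonglongrightarrow> g z"
        using tendsto_uniform_limitI[OF lim[OF R]] zR by auto
    qed simp
    \<comment> \<open>The theorem supplies its own limit \<open>G\<close>, described on
      \<open>ball 0 R\<close> only. There it coincides with \<open>g\<close>, and openness of the
      ball transfers the derivative.\<close>
    then obtain G where G: "\<And>x. x \<in> ball 0 R \<Longrightarrow> (\<lambda>n. f n x) \<longlonglongrightarrow> G x"
      "\<And>x. x \<in> ball 0 R \<Longrightarrow> (G has_derivative g' x) (at x within ball 0 R)"
      by blast
    have "(G has_derivative g' z) (at z)"
      using G(2)[OF zR] at_within_open[OF zR open_ball] by simp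
    moreover have "G x = g x" if "x \<in> ball 0 R" for x
      using G(1)[OF that] tendsto_uniform_limitI[OF lim[OF R], of x] that LIMSEQ_unique by auto
    ultimately have "(g has_derivative g' z) (at z)"
      using has_derivative_transform_within_open[OF _ open_ball zR] by blast
    moreover have "g' z (c *s v) = c * g' z v" for c v
    proof (rule LIMSEQ_unique[OF g'_lim[OF zR]])
      show "(\<lambda>j. f' j z (c *s v)) \<longlonglongrightarrow> c * g' z v"
        unfolding f'_deriv(2)[OF zR] by (intro tendsto_intros g'_lim zR)
    qed
    ultimately show "\<exists>D. (g has_derivative D) (at z) \<and> (\<forall>c v. D (c *s v) = c * D v)"
      by blast
  qed
  then show ?thesis using lim by (rule that)
qed

text \<open>Cauchy estimates turn local bounds into common Lipschitz constants, so Arzela-Ascoli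
  applies on each ball of an exhaustion, and a diagonal subsequence serves all of them.
  \<open>P\<close> asks for a uniformly Cauchy sequence, which names no limit, so limits on
  different balls never have to be matched.\<close>

theorem holomorphic_ball_Montel:
  fixes f :: "nat \<Rightarrow> complex ^ 'n \<Rightarrow> complex"
  assumes f: "\<And>j. holomorphic_ball (f j)"
    and bound: "\<And>R. 0 < R \<Longrightarrow> R < 1 \<Longrightarrow> \<exists>M. \<forall>j. \<forall>z\<in>cball 0 R. cmod (f j z) \<le> M"
  obtains g s where "holomorphic_ball g" "strict_mono (s :: nat \<Rightarrow> nat)"
    "\<And>R. 0 < R \<Longrightarrow> R < 1 \<Longrightarrow> uniform_limit (cball 0 R) (\<lambda>j. f (s j)) g sequentially"
proof -
  \<comment> \<open>The offset 2 makes the first radius \<open>1 / 2\<close>, hence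
    positive.\<close>
  define R where "R i = 1 - 1 / (real i + 2)" for i :: nat
  have R: "0 < R i" "R i < 1" for i by (simp_all add: R_def)
  define P where "P i s = uniformly_Cauchy_on (cball 0 (R i)) (\<lambda>j. f (s j))" for i and s :: "nat \<Rightarrow> nat"
  have ex: "\<exists>k. strict_mono (k :: nat \<Rightarrow> nat) \<and> P i (r \<circ> k)" for i and r :: "nat \<Rightarrow> nat"
  proof -
    have R': "0 < (1 + R i) / 2" "(1 + R i) / 2 < 1" using R[of i] by auto
    obtain M where M: "\<And>j z. z \<in> cball 0 ((1 + R i) / 2) \<Longrightarrow> cmod (f j z) \<le> M"
      using bound[OF R'] by blast
    have "cmod (f 0 0) \<le> M" using R' by (intro M) simp
    then have M0: "0 \<le> M" using norm_ge_zero order_trans by blast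
    \<comment> \<open>The added 1 makes \<open>C\<close> positive even if \<open>M = 0\<close>, so
      that \<open>e / C\<close> can serve as modulus of continuity.\<close>
    define C where "C = M / ((1 - R i) / 2) + 1"
    have C: "0 < C" using M0 R[of i] by (simp add: C_def add_nonneg_pos)
    have Lip: "norm (f j x - f j y) \<le> C * norm (x - y)" if "x \<in> cball 0 (R i)" "y \<in> cball 0 (R i)" for j x y
    proof (rule differentiable_bound[where S = "cball 0 (R i)" and f' = "\<lambda>x. frechet_derivative (f j) (at x)"])
      fix x :: "complex ^ 'n" assume x: "x \<in> cball 0 (R i)"
      then have "x \<in> ball 0 1" using R[of i] by auto
      then show "(f j has_derivative frechet_derivative (f j) (at x)) (at x within cball 0 (R i))"
        using holomorphic_ball_frechet_derivative(1)[OF f] has_derivative_at_withinI by blast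
      have "norm (frechet_derivative (f j) (at x) h) \<le> C * norm h" for h
        using holomorphic_ball_derivative_bound[OF f R M x, of j h] norm_ge_zero[of h]
        unfolding C_def distrib_right by linarith
      then show "onorm (frechet_derivative (f j) (at x)) \<le> C" by (rule onorm_le)
    qed (use that in auto)
    obtain g k where k: "strict_mono (k :: nat \<Rightarrow> nat)"
      and lim: "\<And>e. 0 < e \<Longrightarrow> \<exists>N. \<forall>n x. n \<ge> N \<and> x \<in> cball 0 (R i) \<longrightarrow> norm (f (r (k n)) x - g x) < e"
    proof (rule Arzela_Ascoli[of "cball 0 (R i)" "\<lambda>j. f (r j)" M])
      show "norm (f (r n) x) \<le> M" if "x \<in> cball 0 (R i)" for n x
        using M that R[of i] by simp
      show "\<exists>d>0. \<forall>n y. y \<in> cball 0 (R i) \<and> norm (x - y) < d \<longrightarrow> norm (f (r n) x - f (r n) y) < e"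
        if x: "x \<in> cball 0 (R i)" and "0 < e" for x and e :: real
      proof (intro exI conjI allI impI)
        show "0 < e / C" using \<open>0 < e\<close> C by simp
        fix n y assume y: "y \<in> cball 0 (R i) \<and> norm (x - y) < e / C"
        then have "C * norm (x - y) < e" using C by (simp add: field_simps)
        with Lip[OF x, of y "r n"] y show "norm (f (r n) x - f (r n) y) < e" by simp
      qed
    qed auto
    have "uniform_limit (cball 0 (R i)) (\<lambda>n. f (r (k n))) g sequentially"
      unfolding uniform_limit_sequentially_iff dist_norm using lim by meson
    from uniformly_convergent_Cauchy[OF uniformly_convergentI[OF this]]
    have "P i (r \<circ> k)" by (simp add: P_def)
    with k show ?thesis by blast
  qed
  obtain k where k: "strict_mono (k :: nat \<Rightarrow> nat)" "\<And>i. P i (id \<circ> k)"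
  proof (rule subsequence_diagonalization_lemma[where r = id and P = P])
    show "\<And>i r. \<exists>k. strict_mono (k :: nat \<Rightarrow> nat) \<and> P i (r \<circ> k)" by (rule ex)
    \<comment> \<open>From index \<open>N\<close> on, \<open>k2\<close> picks entries of
      \<open>k1\<close> at positions not before its own, so a Cauchy threshold \<open>M\<close> for
      \<open>k1\<close> becomes \<open>max M N\<close>.\<close>
    show "P i (r \<circ> k2)" if P: "P i (r \<circ> k1)" and sub: "\<And>j. N \<le> j \<Longrightarrow> \<exists>j'\<ge>j. k2 j = k1 j'"
      for i r and k1 k2 :: "nat \<Rightarrow> nat" and N
      unfolding P_def
    proof (rule uniformly_Cauchy_onI)
      fix e :: real assume "0 < e"
      then obtain M where M: "\<And>x m n. x \<in> cball 0 (R i) \<Longrightarrow> m \<ge> M \<Longrightarrow> n \<ge> M \<Longrightarrow>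
          dist (f (r (k1 m)) x) (f (r (k1 n)) x) < e"
        using P unfolding P_def uniformly_Cauchy_on_def o_def by meson
      have "dist (f (r (k2 m)) x) (f (r (k2 n)) x) < e"
        if x: "x \<in> cball 0 (R i)" and mn: "m \<ge> max M N" "n \<ge> max M N" for x m n
      proof -
        obtain m' where m': "m' \<ge> m" "k2 m = k1 m'" using sub[of m] mn by auto
        obtain n' where n': "n' \<ge> n" "k2 n = k1 n'" using sub[of n] mn by auto
        have "M \<le> m'" "M \<le> n'" using m' n' mn by auto
        from M[OF x this] show ?thesis by (simp add: m' n')
      qed
      then show "\<exists>M. \<forall>x\<in>cball 0 (R i). \<forall>m\<ge>M. \<forall>n\<ge>M. dist (f ((r \<circ> k2) m) x) (f ((r \<circ> k2) n) x) < e"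
        unfolding o_def by meson
    qed
  qed blast
  have "uniformly_Cauchy_on (cball 0 r) (\<lambda>j. f (k j))" if r: "0 < r" "r < 1" for r
  proof -
    obtain i where i: "inverse (real (Suc i)) < 1 - r"
      using reals_Archimedean[of "1 - r"] r(2) by auto
    have "1 / (real i + 2) \<le> inverse (real (Suc i))" by (simp add: field_simps)
    with i have "r \<le> R i" unfolding R_def by linarith
    then have "cball 0 r \<subseteq> (cball 0 (R i) :: (complex ^ 'n) set)" by auto
    moreover have "uniformly_Cauchy_on (cball 0 (R i)) (\<lambda>j. f (k j))"
      using k(2)[of i] by (simp add: P_def)
    ultimately show ?thesis
      unfolding uniformly_Cauchy_on_def by (meson subsetD)
  qed
  then obtain g where "holomorphic_ball g"
    "\<And>r. 0 < r \<Longrightarrow> r < 1 \<Longrightarrow> uniform_limit (cball 0 r) (\<lambda>j. f (k j)) g sequentially"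
    using holomorphic_ball_uniform_sequence[of "\<lambda>j. f (k j)"] f by blast
  then show ?thesis using k(1) that by blast
qed

lemma compact_subset_cball:
  fixes A :: "'a::real_normed_vector set"
  assumes "compact A" "A \<subseteq> ball 0 1"
  obtains R where "0 < R" "R < 1" "A \<subseteq> cball 0 R"
proof (cases "A = {}")
  case False
  obtain x where x: "x \<in> A" "\<And>y. y \<in> A \<Longrightarrow> norm y \<le> norm x"
    using continuous_attains_sup[OF assms(1) False, of norm] continuous_on_norm_id by blast
  have "norm x < 1" using x(1) assms(2) by auto
  show ?thesis
  proof (rule that[of "(1 + norm x) / 2"])
    show "A \<subseteq> cball 0 ((1 + norm x) / 2)"
      using x(2) \<open>norm x < 1\<close> by fastforce
  qed (use \<open>norm x < 1\<close> in \<open>simp_all add: add_pos_nonneg\<close>)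
qed (use that[of "1/2"] in simp)

section \<open>The weighted Bergman space\<close>

lemma space_ball_volume_measure [simp]: "space ball_volume_measure = ball 0 1"
  by (simp add: ball_volume_measure_def space_restrict_space)

lemma sets_ball_volume_measure [simp]:
  "sets ball_volume_measure = sets (restrict_space borel (ball 0 1))"
  by (simp add: ball_volume_measure_def cong: sets_restrict_space_cong)

lemma continuous_on_ball_measurable:
  assumes "sets M = sets (restrict_space borel (ball 0 1))" "continuous_on (ball 0 1) f"
  shows "f \<in> borel_measurable M"
  using borel_measurable_continuous_on_restrict[OF assms(2)] measurable_cong_sets[OF assms(1) refl]
  by blast

lemma nn_integral_ball_volume_measure:
  fixes f :: "complex ^ 'n \<Rightarrow> ennreal"
  assumes "f \<in> borel_measurable ball_volume_measure"
  shows "(\<integral>\<^sup>+z. f z \<partial>ball_volume_measure) * emeasure lborel (ball (0 :: complex ^ 'n) 1) =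
    (\<integral>\<^sup>+z. f z * indicator (ball 0 1) z \<partial>lborel)"
proof -
  let ?R = "restrict_space lborel (ball (0 :: complex ^ 'n) 1)"
  let ?v = "emeasure lborel (ball (0 :: complex ^ 'n) 1)"
  have f: "f \<in> borel_measurable ?R"
    using assms by (simp add: ball_volume_measure_def measurable_cong_sets[OF sets_uniform_measure refl])
  have B: "ball 0 1 \<in> sets ?R" by (simp add: sets_restrict_space_iff)
  have v: "emeasure ?R (ball 0 1) = ?v" by (simp add: emeasure_restrict_space)
  have "?v \<noteq> 0" "?v \<noteq> \<infinity>"
    using emeasure_lborel_ball_finite[of "0 :: complex ^ 'n" 1] emeasure_ball[of 1 "0 :: complex ^ 'n"]
      unit_ball_vol_pos[of "DIM(complex ^ 'n)", THEN less_imp_neq]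
    by (auto simp del: DIM_cart)
  then have "?v / ?v = 1" by (intro ennreal_divide_self) (simp_all add: less_top)
  then have "(\<integral>\<^sup>+z. f z \<partial>ball_volume_measure) * ?v = (\<integral>\<^sup>+z. f z * indicator (ball 0 1) z \<partial>?R)"
    unfolding ball_volume_measure_def nn_integral_uniform_measure[OF f B] v
    by (simp add: ennreal_divide_times)
  also have "\<dots> = (\<integral>\<^sup>+z. f z * indicator (ball 0 1) z \<partial>lborel)"
    by (subst nn_integral_restrict_space) (auto simp: indicator_inter_arith[symmetric] mult.assoc)
  finally show ?thesis .
qed

text \<open>Fatou's lemma with a bound depending on \<open>n\<close>: a constant bound shows that
  norm balls are closed under pointwise limits, a convergent one carries the Carleson inequality
  from approximants to their limit.\<close>

lemma nn_integral_le_of_pointwise_limit: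
  assumes [measurable]: "\<And>n. u n \<in> borel_measurable M"
    and lim: "\<And>x. x \<in> space M \<Longrightarrow> (\<lambda>n. u n x) \<longlonglongrightarrow> (v x :: ennreal)"
    and bound: "\<And>n. (\<integral>\<^sup>+x. u n x \<partial>M) \<le> c n" and c: "c \<longlonglongrightarrow> d"
  shows "(\<integral>\<^sup>+x. v x \<partial>M) \<le> d"
proof -
  have "(\<integral>\<^sup>+x. v x \<partial>M) = (\<integral>\<^sup>+x. liminf (\<lambda>n. u n x) \<partial>M)"
    by (intro nn_integral_cong lim_imp_Liminf[symmetric] lim) simp_all
  also have "\<dots> \<le> liminf (\<lambda>n. \<integral>\<^sup>+x. u n x \<partial>M)"
    by (rule nn_integral_liminf) measurable
  also have "\<dots> \<le> liminf c"
    by (intro Liminf_mono always_eventually allI bound)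
  also have "\<dots> = d" using c by (intro lim_imp_Liminf) simp_all
  finally show ?thesis .
qed

locale radial_weight =
  fixes \<rho> :: "real \<Rightarrow> real"
  assumes pos: "0 \<le> x \<Longrightarrow> x < 1 \<Longrightarrow> 0 < \<rho> x"
    and cont: "continuous_on {0..<1} \<rho>"
begin

lemma weight_continuous_on: "continuous_on (ball 0 1) (\<lambda>z :: complex ^ 'n. \<rho> (norm z))"
  by (rule continuous_on_compose2[OF cont]) (auto intro: continuous_intros)

lemma weight_pos: "z \<in> ball 0 1 \<Longrightarrow> 0 < \<rho> (norm (z :: complex ^ 'n))"
  by (rule pos) auto

lemma weighted_square_nonneg:
  "z \<in> ball 0 1 \<Longrightarrow> 0 \<le> (cmod w)\<^sup>2 * \<rho> (norm (z :: complex ^ 'n))"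
  by (intro mult_nonneg_nonneg less_imp_le[OF weight_pos]) auto

lemma weighted_square_measurable:
  fixes f :: "complex ^ 'n \<Rightarrow> complex"
  assumes "holomorphic_ball f"
  shows "(\<lambda>z. (cmod (f z))\<^sup>2 * \<rho> (norm z)) \<in> borel_measurable ball_volume_measure"
  by (intro continuous_on_ball_measurable continuous_intros weight_continuous_on
      holomorphic_ball_continuous_on assms) simp

lemma bergman_spaceD:
  assumes "f \<in> bergman_space \<rho>"
  shows "holomorphic_ball f" "integrable ball_volume_measure (\<lambda>z. (cmod (f z))\<^sup>2 * \<rho> (norm z))"
  using assms by (auto simp: bergman_space_def)

lemma bergman_inner_integrable:
  fixes f g :: "complex ^ 'n \<Rightarrow> complex"
  assumes f: "f \<in> bergman_space \<rho>" and g: "g \<in> bergman_space \<rho>"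
  shows "integrable ball_volume_measure (\<lambda>z. f z * cnj (g z) * complex_of_real (\<rho> (norm z)))"
proof (rule Bochner_Integration.integrable_bound)
  show "integrable ball_volume_measure
      (\<lambda>z :: complex ^ 'n. (cmod (f z))\<^sup>2 * \<rho> (norm z) + (cmod (g z))\<^sup>2 * \<rho> (norm z))"
    using bergman_spaceD(2)[OF f] bergman_spaceD(2)[OF g] by simp
  show "(\<lambda>z. f z * cnj (g z) * complex_of_real (\<rho> (norm z))) \<in> borel_measurable ball_volume_measure"
    using f g by (intro continuous_on_ball_measurable continuous_intros weight_continuous_on
        holomorphic_ball_continuous_on bergman_spaceD) auto
  show "AE z in ball_volume_measure. norm (f z * cnj (g z) * complex_of_real (\<rho> (norm z))) \<le>
      norm ((cmod (f z))\<^sup>2 * \<rho> (norm z) + (cmod (g z))\<^sup>2 * \<rho> (norm z))"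
  proof (rule AE_I2)
    fix z :: "complex ^ 'n" assume "z \<in> space ball_volume_measure"
    then have \<rho>: "0 < \<rho> (norm z)" using weight_pos by simp
    have "0 \<le> (cmod (f z) - cmod (g z))\<^sup>2" "0 \<le> cmod (f z) * cmod (g z)" by simp_all
    then have "cmod (f z) * cmod (g z) \<le> (cmod (f z))\<^sup>2 + (cmod (g z))\<^sup>2"
      unfolding power2_diff mult.assoc by linarith
    then have "cmod (f z) * cmod (g z) * \<rho> (norm z) \<le> ((cmod (f z))\<^sup>2 + (cmod (g z))\<^sup>2) * \<rho> (norm z)"
      using \<rho> by (intro mult_right_mono) auto
    then show "norm (f z * cnj (g z) * complex_of_real (\<rho> (norm z))) \<le>
        norm ((cmod (f z))\<^sup>2 * \<rho> (norm z) + (cmod (g z))\<^sup>2 * \<rho> (norm z))"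
      using \<rho> by (simp add: norm_mult distrib_right)
  qed
qed

lemma bergman_space_add:
  fixes f g :: "complex ^ 'n \<Rightarrow> complex"
  assumes f: "f \<in> bergman_space \<rho>" and g: "g \<in> bergman_space \<rho>"
  shows "(\<lambda>z. f z + g z) \<in> bergman_space \<rho>"
proof -
  have hol: "holomorphic_ball (\<lambda>z. f z + g z)"
    using f g by (intro holomorphic_ball_add bergman_spaceD)
  have "integrable ball_volume_measure (\<lambda>z. (cmod (f z + g z))\<^sup>2 * \<rho> (norm z))"
  proof (rule Bochner_Integration.integrable_bound)
    show "integrable ball_volume_measure
        (\<lambda>z :: complex ^ 'n. 2 * ((cmod (f z))\<^sup>2 * \<rho> (norm z)) + 2 * ((cmod (g z))\<^sup>2 * \<rho> (norm z)))"
      using bergman_spaceD(2)[OF f] bergman_spaceD(2)[OF g] by simp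
    show "AE z in ball_volume_measure. norm ((cmod (f z + g z))\<^sup>2 * \<rho> (norm z)) \<le>
        norm (2 * ((cmod (f z))\<^sup>2 * \<rho> (norm z)) + 2 * ((cmod (g z))\<^sup>2 * \<rho> (norm z)))"
    proof (rule AE_I2)
      fix z :: "complex ^ 'n" assume "z \<in> space ball_volume_measure"
      then have \<rho>: "0 < \<rho> (norm z)" using weight_pos by simp
      have "(cmod (f z + g z))\<^sup>2 \<le> (cmod (f z) + cmod (g z))\<^sup>2"
        by (intro power_mono norm_triangle_ineq) simp
      moreover have "0 \<le> (cmod (f z) - cmod (g z))\<^sup>2" by simp
      ultimately have "(cmod (f z + g z))\<^sup>2 \<le> 2 * (cmod (f z))\<^sup>2 + 2 * (cmod (g z))\<^sup>2"
        unfolding power2_diff power2_sum by linarith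
      then have "(cmod (f z + g z))\<^sup>2 * \<rho> (norm z) \<le> (2 * (cmod (f z))\<^sup>2 + 2 * (cmod (g z))\<^sup>2) * \<rho> (norm z)"
        using \<rho> by (intro mult_right_mono) auto
      then show "norm ((cmod (f z + g z))\<^sup>2 * \<rho> (norm z)) \<le>
          norm (2 * ((cmod (f z))\<^sup>2 * \<rho> (norm z)) + 2 * ((cmod (g z))\<^sup>2 * \<rho> (norm z)))"
        using \<rho> by (simp add: distrib_right mult.assoc)
    qed
  qed (rule weighted_square_measurable[OF hol])
  with hol show ?thesis by (simp add: bergman_space_def)
qed

lemma bergman_space_scale:
  fixes f :: "complex ^ 'n \<Rightarrow> complex"
  assumes f: "f \<in> bergman_space \<rho>"
  shows "(\<lambda>z. c * f z) \<in> bergman_space \<rho>"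
proof -
  have "integrable ball_volume_measure (\<lambda>z :: complex ^ 'n. (cmod c)\<^sup>2 * ((cmod (f z))\<^sup>2 * \<rho> (norm z)))"
    using bergman_spaceD(2)[OF f] by simp
  with f show ?thesis
    by (simp add: bergman_space_def holomorphic_ball_scale norm_mult power_mult_distrib mult.assoc)
qed

lemma bergman_inner_self:
  fixes f :: "complex ^ 'n \<Rightarrow> complex"
  shows "bergman_inner \<rho> f f =
    complex_of_real (\<integral>z. (cmod (f z))\<^sup>2 * \<rho> (norm z) \<partial>ball_volume_measure)"
  unfolding bergman_inner_def integral_complex_of_real[symmetric]
  by (simp add: complex_norm_square del: of_real_power)

lemma bergman_norm_eq:
  "bergman_norm \<rho> f = sqrt (Re (bergman_inner \<rho> f f))"
  by (simp add: bergman_norm_def bergman_inner_self)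

lemma weighted_square_integral_nonneg:
  fixes f :: "complex ^ 'n \<Rightarrow> complex"
  shows "0 \<le> (\<integral>z. (cmod (f z))\<^sup>2 * \<rho> (norm z) \<partial>ball_volume_measure)"
  by (intro Bochner_Integration.integral_nonneg weighted_square_nonneg) simp

lemma bergman_norm_nonneg: "0 \<le> bergman_norm \<rho> f"
  by (simp add: bergman_norm_def weighted_square_integral_nonneg)

lemma bergman_semi_inner:
  "complex_semi_inner (bergman_space \<rho> :: (complex ^ 'n \<Rightarrow> complex) set) (bergman_inner \<rho>)"
proof
  show "(\<lambda>x. 0) \<in> (bergman_space \<rho> :: (complex ^ 'n \<Rightarrow> complex) set)"
    by (simp add: bergman_space_def holomorphic_ball_const)
  fix f g h :: "complex ^ 'n \<Rightarrow> complex" and c :: complex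
  assume f: "f \<in> bergman_space \<rho>"
  show "(\<lambda>x. c * f x) \<in> bergman_space \<rho>" using f by (rule bergman_space_scale)
  show "0 \<le> Re (bergman_inner \<rho> f f)"
    by (simp add: bergman_inner_self weighted_square_integral_nonneg)
  assume g: "g \<in> bergman_space \<rho>"
  show "(\<lambda>x. f x + g x) \<in> bergman_space \<rho>" using f g by (rule bergman_space_add)
  show "bergman_inner \<rho> g f = cnj (bergman_inner \<rho> f g)"
  proof -
    have "bergman_inner \<rho> g f =
        (\<integral>z. cnj (f z * cnj (g z) * complex_of_real (\<rho> (norm z))) \<partial>ball_volume_measure)"
      by (simp add: bergman_inner_def mult_ac)
    also have "\<dots> = cnj (bergman_inner \<rho> f g)"
      unfolding bergman_inner_def by (rule Bochner_Integration.integral_cnj)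
    finally show ?thesis .
  qed
  show "bergman_inner \<rho> (\<lambda>x. c * f x) g = c * bergman_inner \<rho> f g"
    unfolding bergman_inner_def by (simp add: mult.assoc)
  assume h: "h \<in> bergman_space \<rho>"
  show "bergman_inner \<rho> (\<lambda>x. f x + g x) h = bergman_inner \<rho> f h + bergman_inner \<rho> g h"
    unfolding bergman_inner_def using bergman_inner_integrable[OF f h] bergman_inner_integrable[OF g h]
    by (simp add: distrib_right)
qed

section \<open>Point evaluations, completeness and the reproducing kernel\<close>

lemma nn_integral_weighted_square:
  fixes f :: "complex ^ 'n \<Rightarrow> complex"
  assumes "f \<in> bergman_space \<rho>"
  shows "(\<integral>\<^sup>+z. ennreal ((cmod (f z))\<^sup>2 * \<rho> (norm z)) \<partial>ball_volume_measure) =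
    ennreal ((bergman_norm \<rho> f)\<^sup>2)"
  unfolding bergman_norm_def real_sqrt_pow2[OF weighted_square_integral_nonneg]
  by (intro nn_integral_eq_integral bergman_spaceD(2)[OF assms] AE_I2 weighted_square_nonneg) simp

lemma bergman_spaceI:
  fixes f :: "complex ^ 'n \<Rightarrow> complex"
  assumes f: "holomorphic_ball f" and "0 \<le> M"
    and bound: "(\<integral>\<^sup>+z. ennreal ((cmod (f z))\<^sup>2 * \<rho> (norm z)) \<partial>ball_volume_measure) \<le> ennreal (M\<^sup>2)"
  shows "f \<in> bergman_space \<rho>" "bergman_norm \<rho> f \<le> M"
proof -
  have "integrable ball_volume_measure (\<lambda>z. (cmod (f z))\<^sup>2 * \<rho> (norm z))"
  proof (rule integrableI_nonneg)
    show "AE z in ball_volume_measure. 0 \<le> (cmod (f z))\<^sup>2 * \<rho> (norm z)"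
      by (intro AE_I2 weighted_square_nonneg) simp
    show "(\<integral>\<^sup>+z. ennreal ((cmod (f z))\<^sup>2 * \<rho> (norm z)) \<partial>ball_volume_measure) < \<infinity>"
      using bound by (simp add: le_less_trans)
  qed (rule weighted_square_measurable[OF f])
  with f show mem: "f \<in> bergman_space \<rho>" by (simp add: bergman_space_def)
  have "(bergman_norm \<rho> f)\<^sup>2 \<le> M\<^sup>2"
    using bound unfolding nn_integral_weighted_square[OF mem] by simp
  then show "bergman_norm \<rho> f \<le> M" using \<open>0 \<le> M\<close> by (rule power2_le_imp_le)
qed

text \<open>Lower semicontinuity of the norm by Fatou; the finite bound also gives membership of the
  limit.\<close>

lemma bergman_space_pointwise_limit:
  fixes f :: "nat \<Rightarrow> complex ^ 'n \<Rightarrow> complex"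
  assumes f: "\<And>j. f j \<in> bergman_space \<rho>" "\<And>j. bergman_norm \<rho> (f j) \<le> M"
    and g: "holomorphic_ball g" and lim: "\<And>z. z \<in> ball 0 1 \<Longrightarrow> (\<lambda>j. f j z) \<longlonglongrightarrow> g z"
  shows "g \<in> bergman_space \<rho>" "bergman_norm \<rho> g \<le> M"
proof -
  have M: "0 \<le> M" using f(2)[of 0] bergman_norm_nonneg order_trans by blast
  have bound: "(\<integral>\<^sup>+z. ennreal ((cmod (g z))\<^sup>2 * \<rho> (norm z)) \<partial>ball_volume_measure) \<le> ennreal (M\<^sup>2)"
  proof (rule nn_integral_le_of_pointwise_limit)
    show "(\<lambda>z. ennreal ((cmod (f j z))\<^sup>2 * \<rho> (norm z))) \<in> borel_measurable ball_volume_measure" for j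
      using weighted_square_measurable[OF bergman_spaceD(1)[OF f(1)]] by (rule measurable_compose) simp
    show "(\<lambda>j. ennreal ((cmod (f j z))\<^sup>2 * \<rho> (norm z))) \<longlonglongrightarrow> ennreal ((cmod (g z))\<^sup>2 * \<rho> (norm z))"
      if "z \<in> space ball_volume_measure" for z
      using lim that by (intro tendsto_ennrealI tendsto_intros) auto
    show "(\<integral>\<^sup>+z. ennreal ((cmod (f j z))\<^sup>2 * \<rho> (norm z)) \<partial>ball_volume_measure) \<le> ennreal (M\<^sup>2)" for j
      unfolding nn_integral_weighted_square[OF f(1)]
      using f(2) bergman_norm_nonneg by (intro ennreal_leI power_mono)
  qed (rule tendsto_const)
  show "g \<in> bergman_space \<rho>" "bergman_norm \<rho> g \<le> M"
    using bergman_spaceI[OF g M bound] by blast+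
qed

text \<open>On \<open>ball z r\<close> the weight is at least its minimum \<open>m\<close> over
  \<open>{0..(1 + R) / 2}\<close>, so the sub-mean-value inequality bounds \<open>m * v r\<close>
  times the squared modulus at \<open>z\<close> by the weighted Lebesgue integral over the unit
  ball. The factor \<open>v 1\<close> undoes the normalisation of the volume measure.\<close>

lemma bergman_evaluation_bound:
  assumes R: "0 < R" "R < 1"
  obtains C where "\<And>(f :: complex ^ 'n \<Rightarrow> complex) z. f \<in> bergman_space \<rho> \<Longrightarrow> z \<in> cball 0 R \<Longrightarrow>
    cmod (f z) \<le> C * bergman_norm \<rho> f"
proof -
  define r where "r = (1 - R) / 2"
  define v where "v s = measure lborel (ball (0 :: complex ^ 'n) s)" for s
  have r: "0 < r" using R by (simp add: r_def)
  have em: "emeasure lborel (ball (0 :: complex ^ 'n) s) = ennreal (v s)" for s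
    unfolding v_def using emeasure_lborel_ball_finite[of "0 :: complex ^ 'n" s]
    by (intro emeasure_eq_ennreal_measure) simp
  have v: "0 < v s" if "0 < s" for s
    using that unit_ball_vol_pos[of "DIM(complex ^ 'n)"]
    by (simp add: v_def content_ball del: DIM_cart)
  have "continuous_on {0..(1 + R) / 2} \<rho>"
    by (rule continuous_on_subset[OF cont]) (use R in auto)
  then obtain x where x: "x \<in> {0..(1 + R) / 2}" "\<And>y. y \<in> {0..(1 + R) / 2} \<Longrightarrow> \<rho> x \<le> \<rho> y"
    using continuous_attains_inf[of "{0..(1 + R) / 2}" \<rho>] R by auto
  define m where "m = \<rho> x"
  have m: "0 < m" unfolding m_def using x(1) R by (intro pos) auto
  have "cmod (f z) \<le> sqrt (v 1 / (m * v r)) * bergman_norm \<rho> f"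
    if f: "f \<in> bergman_space \<rho>" and z: "z \<in> cball 0 R" for f :: "complex ^ 'n \<Rightarrow> complex" and z
  proof -
    have sub: "ball z r \<subseteq> cball 0 ((1 + R) / 2)"
      using cball_half_gap[OF R z] by (auto simp: r_def)
    then have sub1: "ball z r \<subseteq> ball 0 1" using R by (auto simp: subset_eq)
    have meas: "(\<lambda>z. ennreal ((cmod (f z))\<^sup>2 * \<rho> (norm z))) \<in> borel_measurable ball_volume_measure"
      using weighted_square_measurable[OF bergman_spaceD(1)[OF f]] by (rule measurable_compose) simp
    have "ennreal m * (ennreal ((cmod (f z))\<^sup>2) * ennreal (v r)) \<le>
        ennreal m * (\<integral>\<^sup>+w. ennreal ((cmod (f w))\<^sup>2) * indicator (ball z r) w \<partial>lborel)"
      using holomorphic_ball_sub_mean_value_square[OF bergman_spaceD(1)[OF f] sub1]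
      by (intro mult_left_mono) (auto simp: em)
    also have "\<dots> = (\<integral>\<^sup>+w. ennreal m * (ennreal ((cmod (f w))\<^sup>2) * indicator (ball z r) w) \<partial>lborel)"
    proof (rule nn_integral_cmult[symmetric])
      have "continuous_on (ball z r) f"
        using holomorphic_ball_continuous_on[OF bergman_spaceD(1)[OF f]] sub1 continuous_on_subset by blast
      from borel_measurable_continuous_on_indicator[OF _ this]
      have "(\<lambda>w. ennreal ((cmod (indicator (ball z r) w *\<^sub>R f w))\<^sup>2)) \<in> borel_measurable borel"
        by measurable
      moreover have "(\<lambda>w. ennreal ((cmod (indicator (ball z r) w *\<^sub>R f w))\<^sup>2)) =
          (\<lambda>w. ennreal ((cmod (f w))\<^sup>2) * indicator (ball z r) w)"
        by (auto simp: fun_eq_iff indicator_def)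
      ultimately have "(\<lambda>w. ennreal ((cmod (f w))\<^sup>2) * indicator (ball z r) w) \<in> borel_measurable borel"
        by (simp only:)
      then show "(\<lambda>w. ennreal ((cmod (f w))\<^sup>2) * indicator (ball z r) w) \<in> borel_measurable lborel"
        by simp
    qed
    also have "\<dots> \<le> (\<integral>\<^sup>+w. ennreal ((cmod (f w))\<^sup>2 * \<rho> (norm w)) * indicator (ball 0 1) w \<partial>lborel)"
    proof (rule nn_integral_mono)
      fix w :: "complex ^ 'n"
      show "ennreal m * (ennreal ((cmod (f w))\<^sup>2) * indicator (ball z r) w) \<le>
          ennreal ((cmod (f w))\<^sup>2 * \<rho> (norm w)) * indicator (ball 0 1) w"
      proof (cases "w \<in> ball z r")
        case True
        then have w: "w \<in> ball 0 1" "m \<le> \<rho> (norm w)"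
          using sub sub1 x(2) by (auto simp: m_def)
        have "m * (cmod (f w))\<^sup>2 \<le> (cmod (f w))\<^sup>2 * \<rho> (norm w)"
          using w(2) by (simp add: mult.commute[of m] mult_left_mono)
        then show ?thesis
          using True w(1) m by (simp add: ennreal_mult[symmetric] ennreal_leI)
      qed simp
    qed
    also have "\<dots> = (\<integral>\<^sup>+w. ennreal ((cmod (f w))\<^sup>2 * \<rho> (norm w)) \<partial>ball_volume_measure) * ennreal (v 1)"
      using nn_integral_ball_volume_measure[OF meas] by (simp add: em)
    also have "\<dots> = ennreal ((bergman_norm \<rho> f)\<^sup>2) * ennreal (v 1)"
      by (simp add: nn_integral_weighted_square[OF f])
    finally have "m * ((cmod (f z))\<^sup>2 * v r) \<le> (bergman_norm \<rho> f)\<^sup>2 * v 1"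
      using m v[OF r] v[of 1] by (simp add: ennreal_mult[symmetric])
    then have "(cmod (f z))\<^sup>2 \<le> v 1 / (m * v r) * (bergman_norm \<rho> f)\<^sup>2"
      using m v[OF r] by (simp add: field_simps)
    then have "sqrt ((cmod (f z))\<^sup>2) \<le> sqrt (v 1 / (m * v r) * (bergman_norm \<rho> f)\<^sup>2)"
      by (rule real_sqrt_le_mono)
    then show ?thesis
      by (simp only: real_sqrt_mult[of "v 1 / (m * v r)"] real_sqrt_abs
          abs_of_nonneg[OF norm_ge_zero] abs_of_nonneg[OF bergman_norm_nonneg])
  qed
  then show ?thesis by (rule that)
qed

text \<open>Bounded evaluations make a norm-Cauchy sequence locally uniformly Cauchy, which provides
  a holomorphic limit; convergence to it in norm comes from Fatou's lemma.\<close>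

theorem bergman_semi_hilbert:
  "complex_semi_hilbert (bergman_space \<rho> :: (complex ^ 'n \<Rightarrow> complex) set) (bergman_inner \<rho>)"
proof -
  interpret A: complex_semi_inner "bergman_space \<rho> :: (complex ^ 'n \<Rightarrow> complex) set" "bergman_inner \<rho>"
    by (rule bergman_semi_inner)
  show ?thesis
  proof (unfold_locales, fold bergman_norm_eq)
    fix u :: "nat \<Rightarrow> complex ^ 'n \<Rightarrow> complex"
    assume u: "\<And>n. u n \<in> bergman_space \<rho>"
      and Cauchy: "\<And>e. 0 < e \<Longrightarrow> \<exists>M. \<forall>m\<ge>M. \<forall>n\<ge>M. bergman_norm \<rho> (\<lambda>x. u m x - u n x) < e"
    have "uniformly_Cauchy_on (cball 0 R) u" if R: "0 < R" "R < 1" for R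
    proof (rule uniformly_Cauchy_onI)
      obtain C where C: "\<And>(f :: complex ^ 'n \<Rightarrow> complex) z. f \<in> bergman_space \<rho> \<Longrightarrow> z \<in> cball 0 R \<Longrightarrow>
          cmod (f z) \<le> C * bergman_norm \<rho> f"
        using bergman_evaluation_bound[OF R] by blast
      fix e :: real assume "0 < e"
      then have e: "0 < e / (\<bar>C\<bar> + 1)" by (simp add: add_nonneg_pos)
      obtain M where M: "\<And>m n. m \<ge> M \<Longrightarrow> n \<ge> M \<Longrightarrow> bergman_norm \<rho> (\<lambda>x. u m x - u n x) < e / (\<bar>C\<bar> + 1)"
        using Cauchy[OF e] by blast
      have "dist (u m x) (u n x) < e" if "x \<in> cball 0 R" "m \<ge> M" "n \<ge> M" for x m n
      proof -
        let ?N = "bergman_norm \<rho> (\<lambda>x. u m x - u n x)"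
        have "dist (u m x) (u n x) \<le> C * ?N"
          unfolding dist_norm using C[OF A.diff_mem[OF u u] that(1)] .
        also have "\<dots> \<le> (\<bar>C\<bar> + 1) * ?N"
          by (intro mult_right_mono bergman_norm_nonneg) simp
        also have "\<dots> < (\<bar>C\<bar> + 1) * (e / (\<bar>C\<bar> + 1))"
          using M[OF that(2,3)] by (intro mult_strict_left_mono) auto
        also have "\<dots> = e" by simp
        finally show ?thesis .
      qed
      then show "\<exists>M. \<forall>x\<in>cball 0 R. \<forall>m\<ge>M. \<forall>n\<ge>M. dist (u m x) (u n x) < e" by blast
    qed
    then obtain g where g: "holomorphic_ball g"
      and lim: "\<And>R. 0 < R \<Longrightarrow> R < 1 \<Longrightarrow> uniform_limit (cball 0 R) u g sequentially"
      using holomorphic_ball_uniform_sequence[of u] u bergman_spaceD(1) by blast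
    have ptlim: "(\<lambda>j. u j z) \<longlonglongrightarrow> g z" if z: "z \<in> ball 0 1" for z
    proof -
      obtain R where "0 < R" "R < 1" "{z} \<subseteq> cball 0 R"
        using compact_subset_cball[of "{z}"] z by auto
      then show ?thesis using tendsto_uniform_limitI[OF lim] by blast
    qed
    \<comment> \<open>With \<open>n\<close> fixed, \<open>u n - u (j + M)\<close> tends pointwise to
      \<open>u n - g\<close> as \<open>j\<close> grows, and its norm stays below \<open>e\<close>.
      Membership of the limit comes along; \<open>g\<close> itself is recovered by subtracting it
      from \<open>u M\<close>.\<close>
    have close: "(\<lambda>x. u n x - g x) \<in> bergman_space \<rho> \<and> bergman_norm \<rho> (\<lambda>x. u n x - g x) \<le> e"
      if "\<And>m. m \<ge> M \<Longrightarrow> bergman_norm \<rho> (\<lambda>x. u n x - u m x) < e" for n M e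
    proof -
      let ?f = "\<lambda>j x. u n x - u (j + M) x"
      have "?f j \<in> bergman_space \<rho>" "bergman_norm \<rho> (?f j) \<le> e" for j
        using A.diff_mem[OF u u] that[of "j + M"] by auto
      moreover have "(\<lambda>j. ?f j z) \<longlonglongrightarrow> u n z - g z" if "z \<in> ball 0 1" for z
        by (intro tendsto_intros LIMSEQ_ignore_initial_segment ptlim that)
      moreover have "holomorphic_ball (\<lambda>x. u n x - g x)"
        using u g bergman_spaceD(1) by (intro holomorphic_ball_diff) auto
      ultimately show ?thesis
        using bergman_space_pointwise_limit[of ?f e "\<lambda>x. u n x - g x"] by blast
    qed
    obtain M where "\<And>m n. m \<ge> M \<Longrightarrow> n \<ge> M \<Longrightarrow> bergman_norm \<rho> (\<lambda>x. u m x - u n x) < 1"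
      using Cauchy[of 1] by auto
    then have "(\<lambda>x. u M x - g x) \<in> bergman_space \<rho>" using close[of M M 1] by blast
    from A.diff_mem[OF u[of M] this] have "g \<in> bergman_space \<rho>" by simp
    moreover have "(\<lambda>n. bergman_norm \<rho> (\<lambda>x. u n x - g x)) \<longlonglongrightarrow> 0"
    proof (rule LIMSEQ_I)
      fix e :: real assume "0 < e"
      then obtain M where "\<And>m n. m \<ge> M \<Longrightarrow> n \<ge> M \<Longrightarrow> bergman_norm \<rho> (\<lambda>x. u m x - u n x) < e / 2"
        using Cauchy[of "e / 2"] by auto
      then have le: "bergman_norm \<rho> (\<lambda>x. u n x - g x) \<le> e / 2" if "n \<ge> M" for n
        using close[of M n "e / 2"] that by blast
      have "norm (bergman_norm \<rho> (\<lambda>x. u n x - g x) - 0) < e" if "n \<ge> M" for n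
        using le[OF that] \<open>0 < e\<close> by (simp add: bergman_norm_nonneg)
      then show "\<exists>M. \<forall>n\<ge>M. norm (bergman_norm \<rho> (\<lambda>x. u n x - g x) - 0) < e" by blast
    qed
    ultimately show "\<exists>h\<in>bergman_space \<rho>. (\<lambda>n. bergman_norm \<rho> (\<lambda>x. u n x - h x)) \<longlonglongrightarrow> 0"
      by blast
  qed
qed

text \<open>Existence makes the choice in \<open>bergman_kernel\<close> meaningful: evaluation at
  \<open>w\<close> is bounded, and its Riesz representer becomes the column
  \<open>\<lambda>z. K z w\<close>.\<close>

theorem bergman_kernel_reproducing:
  "is_reproducing_kernel \<rho> (bergman_kernel \<rho> :: complex ^ 'n \<Rightarrow> complex ^ 'n \<Rightarrow> complex)"
proof -
  interpret A: complex_semi_hilbert "bergman_space \<rho> :: (complex ^ 'n \<Rightarrow> complex) set" "bergman_inner \<rho>"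
    by (rule bergman_semi_hilbert)
  have "\<exists>h\<in>bergman_space \<rho>. \<forall>f\<in>bergman_space \<rho>. f w = bergman_inner \<rho> f h"
    if w: "w \<in> ball 0 1" for w :: "complex ^ 'n"
  proof -
    obtain R where R: "0 < R" "R < 1" "{w} \<subseteq> cball 0 R"
      using compact_subset_cball[of "{w}"] w by auto
    obtain C where "\<And>(f :: complex ^ 'n \<Rightarrow> complex) z. f \<in> bergman_space \<rho> \<Longrightarrow>
        z \<in> cball 0 R \<Longrightarrow> cmod (f z) \<le> C * bergman_norm \<rho> f"
      using bergman_evaluation_bound[OF R(1,2)] by blast
    then have C: "cmod (f w) \<le> C * bergman_norm \<rho> f" if "f \<in> bergman_space \<rho>" for f
      using that R(3) by simp
    show ?thesis
      by (rule A.Riesz_representation[of "bergman_space \<rho>" "\<lambda>f. f w" C])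
        (use C in \<open>auto simp: A.N_def bergman_norm_eq A.zero_mem A.add_mem A.scale_mem\<close>)
  qed
  then obtain k where "\<And>w :: complex ^ 'n. w \<in> ball 0 1 \<Longrightarrow> k w \<in> bergman_space \<rho> \<and>
      (\<forall>f\<in>bergman_space \<rho>. f w = bergman_inner \<rho> f (k w))"
    by metis
  then have "is_reproducing_kernel \<rho> (\<lambda>z w. k w z)"
    by (simp add: is_reproducing_kernel_def)
  then show ?thesis unfolding bergman_kernel_def by (rule someI[of "is_reproducing_kernel \<rho>"])
qed

end

section \<open>Toeplitz operators and Carleson measures\<close>

lemma integrable_mult_cnj:
  fixes f g :: "'a \<Rightarrow> complex"
  assumes [measurable]: "f \<in> borel_measurable M" "g \<in> borel_measurable M"
    and f: "integrable M (\<lambda>x. (cmod (f x))\<^sup>2)" and g: "integrable M (\<lambda>x. (cmod (g x))\<^sup>2)"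
  shows "integrable M (\<lambda>x. f x * cnj (g x))"
proof (rule Bochner_Integration.integrable_bound)
  show "integrable M (\<lambda>x. (cmod (f x))\<^sup>2 + (cmod (g x))\<^sup>2)"
    using f g by simp
  show "AE x in M. norm (f x * cnj (g x)) \<le> norm ((cmod (f x))\<^sup>2 + (cmod (g x))\<^sup>2)"
  proof (rule AE_I2)
    fix x
    have "0 \<le> (cmod (f x) - cmod (g x))\<^sup>2" "0 \<le> cmod (f x) * cmod (g x)" by simp_all
    then have "cmod (f x) * cmod (g x) \<le> (cmod (f x))\<^sup>2 + (cmod (g x))\<^sup>2"
      unfolding power2_diff mult.assoc by linarith
    then show "norm (f x * cnj (g x)) \<le> norm ((cmod (f x))\<^sup>2 + (cmod (g x))\<^sup>2)"
      by (simp add: norm_mult)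
  qed
  have [measurable]: "cnj \<in> borel_measurable borel"
    by (intro borel_measurable_continuous_onI continuous_intros)
  show "(\<lambda>x. f x * cnj (g x)) \<in> borel_measurable M" by measurable
qed

locale bergman_measure = radial_weight \<rho> for \<rho> :: "real \<Rightarrow> real" +
  fixes \<mu> :: "(complex ^ 'n) measure"
  assumes sets_mu: "sets \<mu> = sets (restrict_space borel (ball 0 1))"

sublocale bergman_measure \<subseteq>
  A: complex_semi_hilbert "bergman_space \<rho> :: (complex ^ 'n \<Rightarrow> complex) set" "bergman_inner \<rho>"
  by (rule bergman_semi_hilbert)

context bergman_measure
begin

abbreviation (input) V :: "(complex ^ 'n \<Rightarrow> complex) set" where "V \<equiv> bergman_space \<rho>"
abbreviation (input) K :: "complex ^ 'n \<Rightarrow> complex ^ 'n \<Rightarrow> complex" where "K \<equiv> bergman_kernel \<rho>"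
abbreviation (input) nrm :: "(complex ^ 'n \<Rightarrow> complex) \<Rightarrow> real" where "nrm \<equiv> bergman_norm \<rho>"
abbreviation (input) T :: "(complex ^ 'n \<Rightarrow> complex) \<Rightarrow> complex ^ 'n \<Rightarrow> complex" where "T \<equiv> toeplitz \<rho> \<mu>"

lemma N_eq: "A.N = nrm"
  by (simp add: fun_eq_iff A.N_def bergman_norm_eq)

lemma space_mu: "space \<mu> = ball 0 1"
  using sets_eq_imp_space_eq[OF sets_mu] by (simp add: space_restrict_space)

lemma measurable_mu: "f \<in> V \<Longrightarrow> f \<in> borel_measurable \<mu>"
  by (intro continuous_on_ball_measurable[OF sets_mu] holomorphic_ball_continuous_on bergman_spaceD(1))

section \<open>Kernel functions: symmetry, density and weak convergence\<close>

lemma kernel_mem: "w \<in> ball 0 1 \<Longrightarrow> (\<lambda>z. K z w) \<in> V"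
  using bergman_kernel_reproducing unfolding is_reproducing_kernel_def by blast

lemma kernel_inner: "w \<in> ball 0 1 \<Longrightarrow> f \<in> V \<Longrightarrow> bergman_inner \<rho> f (\<lambda>z. K z w) = f w"
  using bergman_kernel_reproducing[unfolded is_reproducing_kernel_def] by (blast intro: sym)

text \<open>\<open>K z w\<close> and \<open>K w z\<close> are the inner products of the same two
  columns in opposite order. The symmetry links the Toeplitz integrand, whose integration variable
  is the second argument, with the columns, which are the members of the space.\<close>

lemma kernel_cnj: "z \<in> ball 0 1 \<Longrightarrow> w \<in> ball 0 1 \<Longrightarrow> K z w = cnj (K w z)"
  using A.cnj_commute[OF kernel_mem kernel_mem, of z w]
    kernel_inner[OF _ kernel_mem, of z w] kernel_inner[OF _ kernel_mem, of w z] by simp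

lemma bergman_inner_cong:
  fixes f g f' g' :: "complex ^ 'n \<Rightarrow> complex"
  assumes "\<And>z. z \<in> ball 0 1 \<Longrightarrow> f z = f' z" "\<And>z. z \<in> ball 0 1 \<Longrightarrow> g z = g' z"
  shows "bergman_inner \<rho> f g = bergman_inner \<rho> f' g'"
  unfolding bergman_inner_def using assms by (intro Bochner_Integration.integral_cong) auto

lemma bergman_norm_cong:
  fixes f f' :: "complex ^ 'n \<Rightarrow> complex"
  assumes "\<And>z. z \<in> ball 0 1 \<Longrightarrow> f z = f' z"
  shows "nrm f = nrm f'"
  using bergman_inner_cong[OF assms assms] by (simp add: bergman_norm_eq)

lemma bergman_space_cong:
  fixes f f' :: "complex ^ 'n \<Rightarrow> complex"
  assumes f: "f \<in> V" and eq: "\<And>z. z \<in> ball 0 1 \<Longrightarrow> f z = f' z"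
  shows "f' \<in> V"
proof -
  have "integrable ball_volume_measure (\<lambda>z. (cmod (f' z))\<^sup>2 * \<rho> (norm z))"
    using bergman_spaceD(2)[OF f] eq
    by (rule_tac Bochner_Integration.integrable_cong[THEN iffD1, OF refl]) auto
  then show ?thesis
    using holomorphic_ball_cong[OF bergman_spaceD(1)[OF f] eq] by (simp add: bergman_space_def)
qed

text \<open>Riesz on \<open>W\<close>, applied to the inner product with \<open>f\<close>, gives a
  norm limit \<open>h\<close> of elements of \<open>W\<close> with \<open>f - h\<close> orthogonal
  to \<open>W\<close>; as \<open>W\<close> contains the kernel functions, \<open>h = f\<close> on
  the ball. An arbitrary subspace in place of the span allows \<open>W\<close> to be the set of
  functions with a desired property.\<close>

lemma kernel_subspace_dense:
  assumes W: "W \<subseteq> V" "(\<lambda>x. 0) \<in> W" "\<And>w. w \<in> ball 0 1 \<Longrightarrow> (\<lambda>z. K z w) \<in> W"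
    and W_add: "\<And>f g. f \<in> W \<Longrightarrow> g \<in> W \<Longrightarrow> (\<lambda>x. f x + g x) \<in> W"
    and W_scale: "\<And>f c. f \<in> W \<Longrightarrow> (\<lambda>x. c * f x) \<in> W"
    and f: "f \<in> V"
  obtains u where "\<And>n::nat. u n \<in> W" "(\<lambda>n. nrm (\<lambda>x. u n x - f x)) \<longlonglongrightarrow> 0"
proof -
  have WV: "g \<in> V" if "g \<in> W" for g using W(1) that by blast
  obtain h u where h: "h \<in> V" and u: "\<And>n::nat. u n \<in> W"
    and lim: "(\<lambda>n. A.N (\<lambda>x. u n x - h x)) \<longlonglongrightarrow> 0"
    and inner: "\<And>g. g \<in> W \<Longrightarrow> bergman_inner \<rho> g f = bergman_inner \<rho> g h"
  proof (rule A.Riesz_representation[of W "\<lambda>g. bergman_inner \<rho> g f" "A.N f"])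
    show "cmod (bergman_inner \<rho> g f) \<le> A.N f * A.N g" if "g \<in> W" for g
      using A.Cauchy_Schwarz[OF WV[OF that] f] by (simp add: mult.commute)
  qed (use W W_add W_scale WV f A.add_left A.scale_left in auto)
  have "h w = f w" if w: "w \<in> ball 0 1" for w
    using inner[OF W(3)[OF w]] A.cnj_commute[OF f kernel_mem[OF w]] A.cnj_commute[OF h kernel_mem[OF w]]
      kernel_inner[OF w f] kernel_inner[OF w h] by simp
  then have "nrm (\<lambda>x. u n x - f x) = A.N (\<lambda>x. u n x - h x)" for n
    unfolding N_eq by (intro bergman_norm_cong) simp
  with u lim show ?thesis by (intro that[of u]) simp_all
qed

lemma norm_limit_pointwise:
  assumes u: "\<And>n. u n \<in> V" and f: "f \<in> V" and lim: "(\<lambda>n. nrm (\<lambda>x. u n x - f x)) \<longlonglongrightarrow> 0"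
    and z: "z \<in> ball 0 1"
  shows "(\<lambda>n. u n z) \<longlonglongrightarrow> f z"
proof (rule LIM_zero_cancel, rule Lim_null_comparison[OF always_eventually])
  show "\<forall>n. norm (u n z - f z) \<le> nrm (\<lambda>x. u n x - f x) * nrm (\<lambda>x. K x z)"
    using A.Cauchy_Schwarz[OF A.diff_mem[OF u f] kernel_mem[OF z]]
      kernel_inner[OF z A.diff_mem[OF u f]] by (simp add: N_eq)
  show "(\<lambda>n. nrm (\<lambda>x. u n x - f x) * nrm (\<lambda>x. K x z)) \<longlonglongrightarrow> 0"
    using tendsto_mult[OF lim tendsto_const] by simp
qed

lemma norm_limit_norm:
  assumes u: "\<And>n. u n \<in> V" and f: "f \<in> V" and lim: "(\<lambda>n. nrm (\<lambda>x. u n x - f x)) \<longlonglongrightarrow> 0"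
  shows "(\<lambda>n. nrm (u n)) \<longlonglongrightarrow> nrm f"
proof (rule LIM_zero_cancel, rule Lim_null_comparison[OF always_eventually lim])
  show "\<forall>n. norm (nrm (u n) - nrm f) \<le> nrm (\<lambda>x. u n x - f x)"
    using A.N_abs_diff_le[OF u f] by (simp add: N_eq)
qed

text \<open>A kernel function pairs with \<open>f j\<close> to \<open>cnj (f j w)\<close>, so
  pointwise convergence is weak convergence tested on kernel functions; the norm bound extends it to
  their closure.\<close>

lemma weakly_null:
  assumes f: "\<And>j. f j \<in> V" "\<And>j. nrm (f j) \<le> M"
    and lim: "\<And>z. z \<in> ball 0 1 \<Longrightarrow> (\<lambda>j. f j z) \<longlonglongrightarrow> 0" and g: "g \<in> V"
  shows "(\<lambda>j. bergman_inner \<rho> g (f j)) \<longlonglongrightarrow> 0"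
proof -
  define W where "W = {g \<in> V. (\<lambda>j. bergman_inner \<rho> g (f j)) \<longlonglongrightarrow> 0}"
  have M: "0 \<le> M" using f(2)[of 0] bergman_norm_nonneg[of "f 0"] by linarith
  obtain u where u: "\<And>n::nat. u n \<in> W" and u_lim: "(\<lambda>n. nrm (\<lambda>x. u n x - g x)) \<longlonglongrightarrow> 0"
  proof (rule kernel_subspace_dense[of W g])
    show "(\<lambda>z. K z w) \<in> W" if w: "w \<in> ball 0 1" for w
    proof -
      have "(\<lambda>j. cnj (f j w)) \<longlonglongrightarrow> cnj 0" by (intro tendsto_cnj lim w)
      moreover have "bergman_inner \<rho> (\<lambda>z. K z w) (f j) = cnj (f j w)" for j
        using A.cnj_commute[OF f(1)[of j] kernel_mem[OF w]] kernel_inner[OF w f(1)[of j]] by simp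
      ultimately show ?thesis using kernel_mem[OF w] by (simp add: W_def)
    qed
    show "(\<lambda>x. 0) \<in> W"
      using A.zero_mem A.scale_left[OF A.zero_mem f(1), of 0] by (simp add: W_def)
    show "(\<lambda>x. a x + b x) \<in> W" if "a \<in> W" "b \<in> W" for a b
      using that tendsto_add[of "\<lambda>j. bergman_inner \<rho> a (f j)" 0 sequentially "\<lambda>j. bergman_inner \<rho> b (f j)" 0]
      by (simp add: W_def A.add_mem A.add_left f(1))
    show "(\<lambda>x. c * a x) \<in> W" if "a \<in> W" for a c
      using that tendsto_mult[OF tendsto_const[of c], of "\<lambda>j. bergman_inner \<rho> a (f j)" 0 sequentially]
      by (simp add: W_def A.scale_mem A.scale_left f(1))
  qed (use g in \<open>auto simp: W_def\<close>)
  have uV: "u n \<in> V" for n using u by (simp add: W_def)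
  show ?thesis
  proof (rule LIMSEQ_I)
    fix e :: real assume e: "0 < e"
    \<comment> \<open>\<open>M + 1\<close> in place of \<open>M\<close> avoids a division by
      zero.\<close>
    then have "0 < e / (2 * (M + 1))" using M by simp
    from LIMSEQ_D[OF u_lim this] obtain n where "norm (nrm (\<lambda>x. u n x - g x) - 0) < e / (2 * (M + 1))"
      by blast
    then have n: "nrm (\<lambda>x. u n x - g x) < e / (2 * (M + 1))" by simp
    have "(\<lambda>j. bergman_inner \<rho> (u n) (f j)) \<longlonglongrightarrow> 0" using u by (simp add: W_def)
    from LIMSEQ_D[OF this, of "e / 2"] e
    obtain J where J: "\<And>j. j \<ge> J \<Longrightarrow> cmod (bergman_inner \<rho> (u n) (f j)) < e / 2" by auto
    have "cmod (bergman_inner \<rho> g (f j)) < e" if j: "j \<ge> J" for j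
    proof -
      have "cmod (bergman_inner \<rho> (u n) (f j) - bergman_inner \<rho> g (f j)) \<le> nrm (\<lambda>x. u n x - g x) * nrm (f j)"
        using A.Cauchy_Schwarz[OF A.diff_mem[OF uV g] f(1)] by (simp add: A.diff_left[OF uV g f(1)] N_eq)
      also have "\<dots> \<le> e / (2 * (M + 1)) * (M + 1)"
        using n f(2)[of j] M e by (intro mult_mono) (auto simp: bergman_norm_nonneg)
      also have "\<dots> = e / 2" using M by (simp add: field_simps)
      finally show ?thesis
        using J[OF j] norm_triangle_sub[of "bergman_inner \<rho> g (f j)" "bergman_inner \<rho> (u n) (f j)"]
        by (simp add: norm_minus_commute)
    qed
    then show "\<exists>J. \<forall>j\<ge>J. norm (bergman_inner \<rho> g (f j) - 0) < e" by auto
  qed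
qed

section \<open>The form of the measure under the Carleson inequality\<close>

definition mu_form :: "(complex ^ 'n \<Rightarrow> complex) \<Rightarrow> (complex ^ 'n \<Rightarrow> complex) \<Rightarrow> complex" where
  "mu_form f g = (\<integral>z. f z * cnj (g z) \<partial>\<mu>)"

lemma mu_form_self: "mu_form f f = complex_of_real (\<integral>z. (cmod (f z))\<^sup>2 \<partial>\<mu>)"
  unfolding mu_form_def integral_complex_of_real[symmetric]
  by (simp add: complex_norm_square del: of_real_power)

lemma mu_form_kernel:
  assumes "z \<in> ball 0 1"
  shows "mu_form f (\<lambda>w. K w z) = T f z"
  unfolding mu_form_def toeplitz_def
  using assms by (intro Bochner_Integration.integral_cong) (auto simp: space_mu kernel_cnj[of z])

lemma integrable_kernel_iff:
  assumes "z \<in> ball 0 1"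
  shows "integrable \<mu> (\<lambda>w. f w * cnj (K w z)) \<longleftrightarrow> integrable \<mu> (\<lambda>w. K z w * f w)"
  using assms by (intro Bochner_Integration.integrable_cong) (auto simp: space_mu kernel_cnj[of z])

lemma toeplitz_scale: "T (\<lambda>z. c * f z) = (\<lambda>z. c * T f z)"
  by (simp add: fun_eq_iff toeplitz_def mult.left_commute[of _ c])

lemma toeplitz_diff:
  assumes "toeplitz_defined \<rho> \<mu>" "f \<in> V" "g \<in> V" "z \<in> ball 0 1"
  shows "T (\<lambda>z. f z - g z) z = T f z - T g z"
  using assms by (simp add: toeplitz_def toeplitz_defined_def right_diff_distrib)

context
  fixes C :: real
  assumes C: "0 \<le> C"
    and carleson: "\<And>f. f \<in> V \<Longrightarrow> (\<integral>\<^sup>+z. ennreal ((cmod (f z))\<^sup>2) \<partial>\<mu>) \<le> ennreal (C * (nrm f)\<^sup>2)"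
begin

lemma carleson_integrable: "f \<in> V \<Longrightarrow> integrable \<mu> (\<lambda>z. (cmod (f z))\<^sup>2)"
proof (rule integrableI_nonneg)
  assume f: "f \<in> V"
  then show "(\<integral>\<^sup>+z. ennreal ((cmod (f z))\<^sup>2) \<partial>\<mu>) < \<infinity>"
    using carleson[OF f] by (simp add: le_less_trans)
  show "(\<lambda>z. (cmod (f z))\<^sup>2) \<in> borel_measurable \<mu>" using measurable_mu[OF f] by simp
qed simp

lemma carleson_integral: "f \<in> V \<Longrightarrow> (\<integral>z. (cmod (f z))\<^sup>2 \<partial>\<mu>) \<le> C * (nrm f)\<^sup>2"
  using carleson nn_integral_eq_integral[OF carleson_integrable] C by fastforce

text \<open>The Carleson inequality makes every product \<open>f cnj g\<close> integrable, which
  additivity of the Bochner integral requires.\<close>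

lemma mu_form_semi_inner: "complex_semi_inner V mu_form"
proof
  show "(\<lambda>x. 0) \<in> V" by (rule A.zero_mem)
  fix f g h :: "complex ^ 'n \<Rightarrow> complex" and c :: complex
  assume f: "f \<in> V"
  show "(\<lambda>x. c * f x) \<in> V" using f by (rule A.scale_mem)
  show "0 \<le> Re (mu_form f f)" by (simp add: mu_form_self)
  assume g: "g \<in> V"
  show "(\<lambda>x. f x + g x) \<in> V" using f g by (rule A.add_mem)
  show "mu_form g f = cnj (mu_form f g)"
  proof -
    have "mu_form g f = (\<integral>z. cnj (f z * cnj (g z)) \<partial>\<mu>)" by (simp add: mu_form_def mult.commute)
    also have "\<dots> = cnj (mu_form f g)"
      unfolding mu_form_def by (rule Bochner_Integration.integral_cnj)
    finally show ?thesis .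
  qed
  show "mu_form (\<lambda>x. c * f x) g = c * mu_form f g" by (simp add: mu_form_def mult.assoc)
  assume h: "h \<in> V"
  have "integrable \<mu> (\<lambda>z. f z * cnj (h z))"
    by (intro integrable_mult_cnj measurable_mu carleson_integrable f h)
  moreover have "integrable \<mu> (\<lambda>z. g z * cnj (h z))"
    by (intro integrable_mult_cnj measurable_mu carleson_integrable g h)
  ultimately show "mu_form (\<lambda>x. f x + g x) h = mu_form f h + mu_form g h"
    by (simp add: mu_form_def distrib_right)
qed

text \<open>Cauchy-Schwarz for \<open>mu_form\<close>, with the Carleson inequality spent on
  \<open>g\<close> only. Keeping the \<open>L^2(\<mu>)\<close> norm of \<open>f\<close> is what
  later lets smallness of \<open>f\<close> in that norm pass to \<open>T f\<close>.\<close>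

lemma mu_form_bound:
  assumes f: "f \<in> V" and g: "g \<in> V"
  shows "cmod (mu_form f g) \<le> sqrt (\<integral>z. (cmod (f z))\<^sup>2 \<partial>\<mu>) * (sqrt C * nrm g)"
proof -
  interpret m: complex_semi_inner V mu_form by (rule mu_form_semi_inner)
  have N: "m.N f = sqrt (\<integral>z. (cmod (f z))\<^sup>2 \<partial>\<mu>)" for f
    by (simp add: m.N_def mu_form_self)
  have "m.N g \<le> sqrt C * nrm g"
    unfolding N using real_sqrt_le_mono[OF carleson_integral[OF g]]
    by (simp add: real_sqrt_mult bergman_norm_nonneg)
  then have "m.N f * m.N g \<le> m.N f * (sqrt C * nrm g)"
    by (intro mult_left_mono m.N_nonneg f)
  with m.Cauchy_Schwarz[OF f g] show ?thesis by (simp add: N)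
qed

lemma carleson_toeplitz_mem: "f \<in> V \<Longrightarrow> T f \<in> V"
  and carleson_toeplitz_inner: "f \<in> V \<Longrightarrow> g \<in> V \<Longrightarrow> bergman_inner \<rho> (T f) g = mu_form f g"
proof -
  interpret m: complex_semi_inner V mu_form by (rule mu_form_semi_inner)
  \<comment> \<open>Agreement with \<open>T f\<close> is claimed on the ball only; outside it
    \<open>T f\<close> is whatever the integral formula returns, and congruence bridges the
    difference.\<close>
  have "\<exists>h\<in>V. (\<forall>z\<in>ball 0 1. h z = T f z) \<and> (\<forall>g\<in>V. bergman_inner \<rho> h g = mu_form f g)"
    if f: "f \<in> V" for f
  proof -
    \<comment> \<open>Riesz represents linear functionals, so \<open>f\<close> occupies the
      conjugate-linear slot; conjugation restores the order afterwards.\<close>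
    obtain h where h: "h \<in> V" and eq: "\<And>g. g \<in> V \<Longrightarrow> mu_form g f = bergman_inner \<rho> g h"
    proof (rule A.Riesz_representation[of V "\<lambda>g. mu_form g f" "sqrt (\<integral>z. (cmod (f z))\<^sup>2 \<partial>\<mu>) * sqrt C"])
      show "cmod (mu_form g f) \<le> sqrt (\<integral>z. (cmod (f z))\<^sup>2 \<partial>\<mu>) * sqrt C * A.N g" if "g \<in> V" for g
        using mu_form_bound[OF f that] m.cnj_commute[OF f that] by (simp add: N_eq mult.assoc)
    qed (use f A.zero_mem A.add_mem A.scale_mem m.add_left m.scale_left in auto)
    have inner: "bergman_inner \<rho> h g = mu_form f g" if "g \<in> V" for g
      using eq[OF that] A.cnj_commute[OF that h] m.cnj_commute[OF that f] by simp
    have "h z = T f z" if z: "z \<in> ball 0 1" for z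
      using inner[OF kernel_mem[OF z]] kernel_inner[OF z h] mu_form_kernel[OF z] by simp
    with h inner show ?thesis by blast
  qed
  note ex = this
  show "T f \<in> V" if "f \<in> V" for f
    using ex[OF that] bergman_space_cong by blast
  show "bergman_inner \<rho> (T f) g = mu_form f g" if "f \<in> V" "g \<in> V" for f g
    using ex[OF that(1)] that(2) bergman_inner_cong[of "T f" _ g g] by metis
qed

lemma carleson_toeplitz_defined: "toeplitz_defined \<rho> \<mu>"
  unfolding toeplitz_defined_def
proof (intro ballI conjI)
  fix f :: "complex ^ 'n \<Rightarrow> complex" and z :: "complex ^ 'n"
  assume f: "f \<in> V"
  then show "T f \<in> V" by (rule carleson_toeplitz_mem)
  assume z: "z \<in> ball 0 1"
  have "integrable \<mu> (\<lambda>w. f w * cnj (K w z))"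
    by (intro integrable_mult_cnj measurable_mu carleson_integrable kernel_mem f z)
  then show "integrable \<mu> (\<lambda>w. K z w * f w)" using integrable_kernel_iff[OF z] by blast
qed

text \<open>Put \<open>g = T f\<close> in the form identity and divide by the norm of
  \<open>T f\<close>.\<close>

lemma carleson_toeplitz_norm:
  assumes f: "f \<in> V"
  shows "nrm (T f) \<le> sqrt C * sqrt (\<integral>z. (cmod (f z))\<^sup>2 \<partial>\<mu>)"
proof (cases "nrm (T f) = 0")
  case False
  then have pos: "0 < nrm (T f)" using bergman_norm_nonneg[of "T f"] by simp
  note Tf = carleson_toeplitz_mem[OF f]
  have "nrm (T f) * nrm (T f) = Re (mu_form f (T f))"
    using A.N_sq[OF Tf] carleson_toeplitz_inner[OF f Tf] by (simp add: N_eq power2_eq_square)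
  also have "\<dots> \<le> cmod (mu_form f (T f))" by (rule complex_Re_le_cmod)
  also have "\<dots> \<le> sqrt (\<integral>z. (cmod (f z))\<^sup>2 \<partial>\<mu>) * (sqrt C * nrm (T f))"
    by (rule mu_form_bound[OF f Tf])
  also have "\<dots> = (sqrt C * sqrt (\<integral>z. (cmod (f z))\<^sup>2 \<partial>\<mu>)) * nrm (T f)" by simp
  finally show ?thesis using pos by (simp only: mult_le_cancel_right_pos)
qed (simp add: C)

end

section \<open>The two equivalences\<close>

theorem carleson_imp_toeplitz_bounded:
  assumes "carleson_measure \<rho> \<mu>"
  shows "toeplitz_bounded \<rho> \<mu>"
proof -
  obtain C where "0 < C" and
    C: "\<And>f. f \<in> V \<Longrightarrow> (\<integral>\<^sup>+z. ennreal ((cmod (f z))\<^sup>2) \<partial>\<mu>) \<le> ennreal (C * (nrm f)\<^sup>2)"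
    using assms unfolding carleson_measure_def by blast
  then have C0: "0 \<le> C" by simp
  have "nrm (T f) \<le> C * nrm f" if f: "f \<in> V" for f
  proof -
    have "nrm (T f) \<le> sqrt C * sqrt (\<integral>z. (cmod (f z))\<^sup>2 \<partial>\<mu>)"
      using carleson_toeplitz_norm[OF C0 C f] .
    also have "\<dots> \<le> sqrt C * sqrt (C * (nrm f)\<^sup>2)"
      using carleson_integral[OF C0 C f] C0 by (intro mult_left_mono real_sqrt_le_mono) auto
    also have "\<dots> = C * nrm f" using C0 by (simp add: real_sqrt_mult bergman_norm_nonneg)
    finally show ?thesis .
  qed
  then show ?thesis
    using carleson_toeplitz_defined[OF C0 C] unfolding toeplitz_bounded_def by blast
qed

text \<open>
  The identity \<open>\<langle>T f, g\<rangle> = \<integral> f cnj g d\<mu>\<close> is immediate for \<open>g\<close> in the span of the kernel functions;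
  taking \<open>f = g\<close> there and passing to the limit by Fatou avoids proving it for all \<open>g\<close>.
\<close>

theorem toeplitz_bounded_imp_carleson:
  assumes "toeplitz_bounded \<rho> \<mu>"
  shows "carleson_measure \<rho> \<mu>"
proof -
  have defd: "\<And>f z. f \<in> V \<Longrightarrow> z \<in> ball 0 1 \<Longrightarrow> integrable \<mu> (\<lambda>w. K z w * f w)"
    and TV: "\<And>f. f \<in> V \<Longrightarrow> T f \<in> V"
    using assms unfolding toeplitz_bounded_def toeplitz_defined_def by blast+
  obtain C0 where C0: "\<And>f. f \<in> V \<Longrightarrow> nrm (T f) \<le> C0 * nrm f"
    using assms unfolding toeplitz_bounded_def by blast
  \<comment> \<open>\<open>carleson_measure\<close> demands a positive constant, while
    \<open>C0\<close> may be zero or negative.\<close>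
  define C where "C = \<bar>C0\<bar> + 1"
  have C: "nrm (T f) \<le> C * nrm f" if "f \<in> V" for f
  proof -
    have "C0 * nrm f \<le> C * nrm f"
      by (intro mult_right_mono) (auto simp: C_def bergman_norm_nonneg)
    with C0[OF that] show ?thesis by linarith
  qed
  \<comment> \<open>Integrability is recorded next to the identity: otherwise the default value 0 of
    the integral would block closure of \<open>W\<close> under addition.\<close>
  define W where "W = {g \<in> V. \<forall>f\<in>V. integrable \<mu> (\<lambda>z. f z * cnj (g z)) \<and>
    bergman_inner \<rho> (T f) g = mu_form f g}"
  have "(\<integral>\<^sup>+z. ennreal ((cmod (f z))\<^sup>2) \<partial>\<mu>) \<le> ennreal (C * (nrm f)\<^sup>2)" if f: "f \<in> V" for f
  proof -
    obtain u where u: "\<And>n::nat. u n \<in> W" and lim: "(\<lambda>n. nrm (\<lambda>x. u n x - f x)) \<longlonglongrightarrow> 0"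
    proof (rule kernel_subspace_dense[of W f])
      show "(\<lambda>z. K z w) \<in> W" if w: "w \<in> ball 0 1" for w
        using kernel_mem[OF w] kernel_inner[OF w TV] mu_form_kernel[OF w] defd[OF _ w]
          integrable_kernel_iff[OF w] by (simp add: W_def)
      show "(\<lambda>x. 0) \<in> W"
        using A.zero_mem A.scale_right[OF A.zero_mem TV, of _ 0] by (simp add: W_def mu_form_def)
      show "(\<lambda>x. a x + b x) \<in> W" if "a \<in> W" "b \<in> W" for a b
        using that by (simp add: W_def A.add_mem A.add_right TV mu_form_def distrib_left)
      show "(\<lambda>x. c * a x) \<in> W" if "a \<in> W" for a c
        using that by (simp add: W_def A.scale_mem A.scale_right TV mu_form_def mult.left_commute[of _ "cnj c"])
    qed (use f in \<open>auto simp: W_def\<close>)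
    have uV: "u n \<in> V" for n using u by (simp add: W_def)
    have bound: "(\<integral>\<^sup>+z. ennreal ((cmod (u n z))\<^sup>2) \<partial>\<mu>) \<le> ennreal (C * (nrm (u n))\<^sup>2)" for n
    proof -
      have int: "integrable \<mu> (\<lambda>z. u n z * cnj (u n z))"
        and form: "bergman_inner \<rho> (T (u n)) (u n) = mu_form (u n) (u n)"
        using u[of n] by (simp_all add: W_def)
      have "integrable \<mu> (\<lambda>z. (cmod (u n z))\<^sup>2)"
        using integrable_norm[OF int] by (simp add: norm_mult power2_eq_square)
      then have "(\<integral>\<^sup>+z. ennreal ((cmod (u n z))\<^sup>2) \<partial>\<mu>) = ennreal (Re (mu_form (u n) (u n)))"
        by (simp add: mu_form_self nn_integral_eq_integral)
      also have "Re (mu_form (u n) (u n)) \<le> cmod (bergman_inner \<rho> (T (u n)) (u n))"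
        unfolding form by (rule complex_Re_le_cmod)
      also have "\<dots> \<le> nrm (T (u n)) * nrm (u n)"
        using A.Cauchy_Schwarz[OF TV[OF uV] uV] by (simp add: N_eq)
      also have "\<dots> \<le> C * nrm (u n) * nrm (u n)"
        by (intro mult_right_mono C uV bergman_norm_nonneg)
      finally show ?thesis by (simp add: power2_eq_square mult.assoc ennreal_leI)
    qed
    show ?thesis
    proof (rule nn_integral_le_of_pointwise_limit[OF _ _ bound])
      show "(\<lambda>z. ennreal ((cmod (u n z))\<^sup>2)) \<in> borel_measurable \<mu>" for n
        using measurable_mu[OF uV] by measurable
      show "(\<lambda>n. ennreal ((cmod (u n z))\<^sup>2)) \<longlonglongrightarrow> ennreal ((cmod (f z))\<^sup>2)" if "z \<in> space \<mu>" for z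
        using that by (intro tendsto_ennrealI tendsto_intros norm_limit_pointwise[OF uV f lim])
          (simp add: space_mu)
      show "(\<lambda>n. ennreal (C * (nrm (u n))\<^sup>2)) \<longlonglongrightarrow> ennreal (C * (nrm f)\<^sup>2)"
        by (intro tendsto_ennrealI tendsto_intros norm_limit_norm[OF uV f lim])
    qed
  qed
  moreover have "0 < C" by (simp add: C_def add_nonneg_pos)
  ultimately show ?thesis unfolding carleson_measure_def by blast
qed

text \<open>\<open>toeplitz_compact\<close> states no norm bound. If none existed, rescaling would
  give a sequence in the closed unit ball whose images have norm exactly \<open>j\<close>, and no
  subsequence of these images stays bounded.\<close>

lemma toeplitz_compact_imp_bounded:
  assumes "toeplitz_compact \<rho> \<mu>"
  shows "toeplitz_bounded \<rho> \<mu>"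
proof (rule ccontr)
  assume unb: "\<not> toeplitz_bounded \<rho> \<mu>"
  have defd: "toeplitz_defined \<rho> \<mu>" using assms by (simp add: toeplitz_compact_def)
  then have TV: "T f \<in> V" if "f \<in> V" for f using that by (simp add: toeplitz_defined_def)
  have "\<exists>f\<in>V. C * nrm f < nrm (T f)" for C
    using unb defd unfolding toeplitz_bounded_def by (meson not_le)
  then obtain F where F: "\<And>C. F C \<in> V" "\<And>C. C * nrm (F C) < nrm (T (F C))"
    by metis
  \<comment> \<open>\<open>F j\<close> violates the bound with constant \<open>j\<close>, so the
    factor \<open>j / nrm (T (F j))\<close> makes its norm at most 1 and the norm of its image
    \<open>j\<close>.\<close>
  define f where "f j = (\<lambda>z. complex_of_real (real j / nrm (T (F (real j)))) * F (real j) z)" for j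
  have Tpos: "0 < nrm (T (F (real j)))" for j
    using F(2)[of "real j"] mult_nonneg_nonneg[of "real j" "nrm (F (real j))"]
      bergman_norm_nonneg[of "F (real j)"] by linarith
  have fV: "f j \<in> V" for j unfolding f_def by (intro A.scale_mem F)
  have f_norm: "nrm (f j) \<le> 1" for j
  proof -
    have "nrm (f j) = real j * nrm (F (real j)) / nrm (T (F (real j)))"
      using A.N_scale[OF F(1), of "complex_of_real (real j / nrm (T (F (real j))))" "real j"] Tpos[of j]
      by (simp add: f_def N_eq norm_divide)
    then show ?thesis using F(2)[of "real j"] Tpos[of j] by simp
  qed
  have Tf_norm: "nrm (T (f j)) = real j" for j
  proof -
    have "nrm (T (f j)) = cmod (complex_of_real (real j / nrm (T (F (real j))))) * nrm (T (F (real j)))"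
      unfolding f_def toeplitz_scale using A.N_scale[OF TV[OF F(1)]] by (simp only: N_eq)
    then show ?thesis using Tpos[of j] by (simp add: norm_divide)
  qed
  have "bergman_bounded_seq \<rho> f" using fV f_norm unfolding bergman_bounded_seq_def by blast
  then obtain g s where g: "g \<in> V" and s: "strict_mono (s :: nat \<Rightarrow> nat)"
    and lim: "(\<lambda>j. nrm (\<lambda>z. T (f (s j)) z - g z)) \<longlonglongrightarrow> 0"
    using assms unfolding toeplitz_compact_def by blast
  from LIMSEQ_D[OF lim zero_less_one] obtain J
    where J: "\<And>j. j \<ge> J \<Longrightarrow> nrm (\<lambda>z. T (f (s j)) z - g z) < 1" by (auto simp: bergman_norm_nonneg)
  \<comment> \<open>At index \<open>max j J\<close> the image is within 1 of \<open>g\<close>, yet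
    its norm is at least \<open>j\<close>, since \<open>s\<close> is strictly increasing.\<close>
  obtain j where j: "1 + nrm g < real j" using reals_Archimedean2 by blast
  have "real (s (max j J)) \<le> nrm (\<lambda>z. T (f (s (max j J))) z - g z) + nrm g"
    using A.N_le_diff[OF TV[OF fV] g, of "s (max j J)"] by (simp add: N_eq Tf_norm)
  moreover have "real j \<le> real (s (max j J))"
    using seq_suble[OF s, of "max j J"] by simp
  ultimately show False using J[of "max j J"] j by simp
qed

theorem toeplitz_compact_imp_vanishing_carleson:
  assumes "toeplitz_compact \<rho> \<mu>"
  shows "vanishing_carleson_measure \<rho> \<mu>"
  unfolding vanishing_carleson_measure_def
proof (intro conjI allI impI)
  show carl: "carleson_measure \<rho> \<mu>"
    using assms by (intro toeplitz_bounded_imp_carleson toeplitz_compact_imp_bounded)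
  then obtain C where "0 < C" and
    C: "\<And>f. f \<in> V \<Longrightarrow> (\<integral>\<^sup>+z. ennreal ((cmod (f z))\<^sup>2) \<partial>\<mu>) \<le> ennreal (C * (nrm f)\<^sup>2)"
    unfolding carleson_measure_def by blast
  then have C0: "0 \<le> C" by simp
  fix f :: "nat \<Rightarrow> complex ^ 'n \<Rightarrow> complex"
  assume "bergman_bounded_seq \<rho> f \<and>
    (\<forall>A. compact A \<and> A \<subseteq> ball 0 1 \<longrightarrow> uniform_limit A f (\<lambda>_. 0) sequentially)"
  then have fV: "\<And>j. f j \<in> V" and unif: "\<And>A. compact A \<Longrightarrow> A \<subseteq> ball 0 1 \<Longrightarrow> uniform_limit A f (\<lambda>_. 0) sequentially"
    and "\<exists>M. \<forall>j. nrm (f j) \<le> M"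
    unfolding bergman_bounded_seq_def by blast+
  then obtain M where M: "\<And>j. nrm (f j) \<le> M" by blast
  have pt: "(\<lambda>j. f j z) \<longlonglongrightarrow> 0" if "z \<in> ball 0 1" for z
    using tendsto_uniform_limitI[OF unif[of "{z}"], of z] that by simp
  define b where "b j = (\<integral>z. (cmod (f j z))\<^sup>2 \<partial>\<mu>)" for j
  have b0: "0 \<le> b j" for j by (simp add: b_def)
  have b_inner: "b j = Re (bergman_inner \<rho> (T (f j)) (f j))" for j
    using carleson_toeplitz_inner[OF C0 C fV fV] by (simp add: mu_form_self b_def)
  have "b \<longlonglongrightarrow> 0"
  \<comment> \<open>Compactness only controls subsequences: if \<open>b\<close> were not null, some
    subsequence would stay above \<open>e\<close>, and compactness is applied to that one.\<close>
  proof (rule LIMSEQ_I, rule ccontr)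
    fix e :: real assume e: "0 < e" and "\<not> (\<exists>J. \<forall>j\<ge>J. norm (b j - 0) < e)"
    then have "\<forall>J. \<exists>j\<ge>J. j \<in> {j. e \<le> b j}" using b0 by (auto simp: not_less)
    then have "infinite {j. e \<le> b j}" by (simp add: infinite_nat_iff_unbounded_le)
    then obtain r where r: "strict_mono (r :: nat \<Rightarrow> nat)" "\<And>j. e \<le> b (r j)"
      using infinite_enumerate by blast
    have "bergman_bounded_seq \<rho> (\<lambda>j. f (r j))"
      using fV M unfolding bergman_bounded_seq_def by blast
    then obtain g s where g: "g \<in> V" and s: "strict_mono (s :: nat \<Rightarrow> nat)"
      and lim: "(\<lambda>j. nrm (\<lambda>z. T (f (r (s j))) z - g z)) \<longlonglongrightarrow> 0"
      using assms unfolding toeplitz_compact_def by blast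
    define k where "k = r \<circ> s"
    have k: "strict_mono k" unfolding k_def using r(1) s by (rule strict_mono_o)
    \<comment> \<open>Split \<open>T f = (T f - g) + g\<close>: the first part is small in norm and
      meets a bounded factor, the second is an inner product with the fixed \<open>g\<close>, where
      weak nullity applies.\<close>
    have bound: "b (k j) \<le> nrm (\<lambda>z. T (f (k j)) z - g z) * M + cmod (bergman_inner \<rho> g (f (k j)))" for j
    proof -
      note Tf = carleson_toeplitz_mem[OF C0 C fV]
      have "b (k j) = Re (bergman_inner \<rho> (\<lambda>z. T (f (k j)) z - g z) (f (k j))) + Re (bergman_inner \<rho> g (f (k j)))"
        by (simp add: b_inner A.diff_left[OF Tf g fV])
      also have "\<dots> \<le> cmod (bergman_inner \<rho> (\<lambda>z. T (f (k j)) z - g z) (f (k j))) + cmod (bergman_inner \<rho> g (f (k j)))"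
        by (intro add_mono complex_Re_le_cmod)
      also have "cmod (bergman_inner \<rho> (\<lambda>z. T (f (k j)) z - g z) (f (k j))) \<le> nrm (\<lambda>z. T (f (k j)) z - g z) * nrm (f (k j))"
        using A.Cauchy_Schwarz[OF A.diff_mem[OF Tf g] fV] by (simp add: N_eq)
      also have "\<dots> \<le> nrm (\<lambda>z. T (f (k j)) z - g z) * M"
        by (intro mult_left_mono M bergman_norm_nonneg)
      finally show ?thesis by simp
    qed
    have "(\<lambda>j. bergman_inner \<rho> g (f (k j))) \<longlonglongrightarrow> 0"
    proof (rule weakly_null[OF fV M _ g])
      show "(\<lambda>j. f (k j) z) \<longlonglongrightarrow> 0" if "z \<in> ball 0 1" for z
        using LIMSEQ_subseq_LIMSEQ[OF pt[OF that] k] by (simp add: o_def)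
    qed
    then have "(\<lambda>j. nrm (\<lambda>z. T (f (k j)) z - g z) * M + cmod (bergman_inner \<rho> g (f (k j)))) \<longlonglongrightarrow> 0 * M + cmod 0"
      using lim by (intro tendsto_intros) (simp_all add: k_def)
    then have "e \<le> 0 * M + cmod 0"
      by (rule tendsto_lowerbound)
        (use r(2) bound in \<open>auto simp: k_def intro!: always_eventually intro: order_trans\<close>)
    with e show False by simp
  qed
  then have "(\<lambda>j. ennreal (b j)) \<longlonglongrightarrow> ennreal 0" by (rule tendsto_ennrealI)
  moreover have "(\<integral>\<^sup>+z. ennreal ((cmod (f j z))\<^sup>2) \<partial>\<mu>) = ennreal (b j)" for j
    unfolding b_def by (intro nn_integral_eq_integral carleson_integrable[OF C0 C fV] AE_I2 zero_le_power2)
  ultimately show "(\<lambda>j. \<integral>\<^sup>+z. ennreal ((cmod (f j z))\<^sup>2) \<partial>\<mu>) \<longlonglongrightarrow> 0" by simp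
qed

theorem vanishing_carleson_imp_toeplitz_compact:
  assumes "vanishing_carleson_measure \<rho> \<mu>"
  shows "toeplitz_compact \<rho> \<mu>"
proof -
  obtain C where "0 < C" and
    C: "\<And>f. f \<in> V \<Longrightarrow> (\<integral>\<^sup>+z. ennreal ((cmod (f z))\<^sup>2) \<partial>\<mu>) \<le> ennreal (C * (nrm f)\<^sup>2)"
    using assms unfolding vanishing_carleson_measure_def carleson_measure_def by blast
  then have C0: "0 \<le> C" by simp
  note defd = carleson_toeplitz_defined[OF C0 C]
  have "\<exists>g\<in>V. \<exists>s. strict_mono s \<and> (\<lambda>j. nrm (\<lambda>z. T (f (s j)) z - g z)) \<longlonglongrightarrow> 0"
    if "bergman_bounded_seq \<rho> f" for f
  proof -
    from that have fV: "\<And>j. f j \<in> V" and "\<exists>M. \<forall>j. nrm (f j) \<le> M"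
      unfolding bergman_bounded_seq_def by blast+
    then obtain M where M: "\<And>j. nrm (f j) \<le> M" by blast
    \<comment> \<open>Bounded evaluations turn the norm bound into the local bounds that Montel's
      theorem asks for; \<open>D\<close> has unknown sign, hence its absolute value.\<close>
    have "\<exists>B. \<forall>j. \<forall>z\<in>cball 0 R. cmod (f j z) \<le> B" if R: "0 < R" "R < 1" for R
    proof -
      obtain D where D: "\<And>(f :: complex ^ 'n \<Rightarrow> complex) z. f \<in> V \<Longrightarrow> z \<in> cball 0 R \<Longrightarrow>
          cmod (f z) \<le> D * nrm f"
        using bergman_evaluation_bound[OF R] by blast
      have "cmod (f j z) \<le> \<bar>D\<bar> * M" if "z \<in> cball 0 R" for j z
      proof -
        have "D * nrm (f j) \<le> \<bar>D\<bar> * M"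
          using M[of j] by (intro mult_mono) (auto simp: bergman_norm_nonneg)
        with D[OF fV that] show ?thesis by (rule order_trans)
      qed
      then show ?thesis by blast
    qed
    then obtain g s where g: "holomorphic_ball g" and s: "strict_mono (s :: nat \<Rightarrow> nat)"
      and lim: "\<And>R. 0 < R \<Longrightarrow> R < 1 \<Longrightarrow> uniform_limit (cball 0 R) (\<lambda>j. f (s j)) g sequentially"
      using holomorphic_ball_Montel[of f] bergman_spaceD(1)[OF fV] by blast
    have unif: "uniform_limit A (\<lambda>j. f (s j)) g sequentially" if A: "compact A" "A \<subseteq> ball 0 1" for A
    proof -
      obtain R where "0 < R" "R < 1" "A \<subseteq> cball 0 R" using compact_subset_cball[OF A] by blast
      then show ?thesis using lim uniform_limit_on_subset by blast
    qed
    have pt: "(\<lambda>j. f (s j) z) \<longlonglongrightarrow> g z" if "z \<in> ball 0 1" for z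
      using tendsto_uniform_limitI[OF unif[of "{z}"], of z] that by simp
    have gV: "g \<in> V"
      using bergman_space_pointwise_limit(1)[of "\<lambda>j. f (s j)" M g] fV M g pt by blast
    define h where "h j = (\<lambda>z. f (s j) z - g z)" for j
    have hV: "h j \<in> V" for j unfolding h_def by (intro A.diff_mem fV gV)
    have "bergman_bounded_seq \<rho> h"
      unfolding bergman_bounded_seq_def
    proof (intro conjI allI hV exI)
      show "nrm (h j) \<le> M + nrm g" for j
        using A.N_triangle_diff[OF fV gV, of "s j"] M[of "s j"] by (simp add: h_def N_eq)
    qed
    moreover have "uniform_limit A h (\<lambda>_. 0) sequentially" if "compact A" "A \<subseteq> ball 0 1" for A
      using unif[OF that] by (simp add: h_def uniform_limit_iff dist_norm)
    ultimately have nn_lim: "(\<lambda>j. \<integral>\<^sup>+z. ennreal ((cmod (h j z))\<^sup>2) \<partial>\<mu>) \<longlonglongrightarrow> 0"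
      using assms unfolding vanishing_carleson_measure_def by blast
    have "(\<integral>\<^sup>+z. ennreal ((cmod (h j z))\<^sup>2) \<partial>\<mu>) = ennreal (\<integral>z. (cmod (h j z))\<^sup>2 \<partial>\<mu>)" for j
      by (intro nn_integral_eq_integral carleson_integrable[OF C0 C hV] AE_I2 zero_le_power2)
    with nn_lim have "(\<lambda>j. ennreal (\<integral>z. (cmod (h j z))\<^sup>2 \<partial>\<mu>)) \<longlonglongrightarrow> ennreal 0" by simp
    then have "(\<lambda>j. \<integral>z. (cmod (h j z))\<^sup>2 \<partial>\<mu>) \<longlonglongrightarrow> 0"
      by (subst (asm) tendsto_ennreal_iff) auto
    then have "(\<lambda>j. sqrt C * sqrt (\<integral>z. (cmod (h j z))\<^sup>2 \<partial>\<mu>)) \<longlonglongrightarrow> sqrt C * sqrt 0"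
      by (intro tendsto_intros)
    then have lim0: "(\<lambda>j. sqrt C * sqrt (\<integral>z. (cmod (h j z))\<^sup>2 \<partial>\<mu>)) \<longlonglongrightarrow> 0" by simp
    \<comment> \<open>The difference of the images is \<open>T (h j)\<close> on the ball, and its
      norm is controlled by the \<open>L^2(\<mu>)\<close> norm of \<open>h j\<close>, which tends to
      0 although the Bergman norm of \<open>h j\<close> need not.\<close>
    have "(\<lambda>j. nrm (\<lambda>z. T (f (s j)) z - T g z)) \<longlonglongrightarrow> 0"
    proof (rule Lim_null_comparison[OF always_eventually lim0], intro allI)
      fix j
      have "nrm (\<lambda>z. T (f (s j)) z - T g z) = nrm (T (h j))"
        unfolding h_def by (intro bergman_norm_cong toeplitz_diff[symmetric] defd fV gV)
      then show "norm (nrm (\<lambda>z. T (f (s j)) z - T g z)) \<le> sqrt C * sqrt (\<integral>z. (cmod (h j z))\<^sup>2 \<partial>\<mu>)"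
        using carleson_toeplitz_norm[OF C0 C hV] by (simp add: bergman_norm_nonneg)
    qed
    moreover have "T g \<in> V" using C0 C gV by (rule carleson_toeplitz_mem)
    ultimately show ?thesis using s by blast
  qed
  with defd show ?thesis unfolding toeplitz_compact_def by blast
qed

end

theorem theorem2p2:
  fixes \<rho> :: "real \<Rightarrow> real" and \<mu> :: "(complex ^ 'n) measure"
  assumes "\<rho> \<in> weight_class_S CARD('n)"
    and "finite_measure \<mu>" and "sets \<mu> = sets (restrict_space borel (ball 0 1))"
  shows "(toeplitz_bounded \<rho> \<mu> \<longleftrightarrow> carleson_measure \<rho> \<mu>) \<and>
         (toeplitz_compact \<rho> \<mu> \<longleftrightarrow> vanishing_carleson_measure \<rho> \<mu>)"
proof -
  interpret bergman_measure \<rho> \<mu>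
  proof
    show "continuous_on {0..<1} \<rho>" "\<And>x. 0 \<le> x \<Longrightarrow> x < 1 \<Longrightarrow> 0 < \<rho> x"
      using assms(1) by (auto simp: weight_class_S_def weight_function_def)
  qed (rule assms(3))
  show ?thesis
    using carleson_imp_toeplitz_bounded toeplitz_bounded_imp_carleson
      vanishing_carleson_imp_toeplitz_compact toeplitz_compact_imp_vanishing_carleson by blast
qed

end
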